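(* Fix a $\Delta^0_0$ formula $\theta(x,y,z)$. There is a primitive recursive function $g:\mathbb{N}\to\mathbb{N}$ such that for every $k\in\mathbb{N}$, if a finite set $X\subseteq\mathbb{N}$ is $\omega^{6k}$-large${}^*(\theta)$ and $g$-sparse, then it is $\mathsf{EM}$-$\omega^k$-large${}^*(\theta)$, i.e. for every coloring $f:[X]^2\to 2$ there is an $f$-transitive subset of $X$ which is $\omega^k$-large${}^*(\theta)$.
   Context: For finite sets $A,B$, write $A<B$ if every element of $A$ is below every element of $B$. Finite sets $E<F$ are $\theta$-apart if $\forall x<\max E\ \exists y<\min F\ \forall z<\max F\ \theta(x,y,z)$. For a family $\mathcal{L}$ of finite sets and $k\in\mathbb{N}$, $\mathcal{L}\cdot k$ is the family of finite sets $F$ containing $k$ pairwise $\theta$-apart sets $X_0<\dots<X_{k-1}\subseteq F$ each in $\mathcal{L}$; $\mathcal{L}\cdot()=\mathcal{L}$ and $\mathcal{L}\cdot(k,k_2,\dots,k_s)=(\mathcal{L}\cdot k)\cdot(k_2,\dots,k_s)$. Let $L^\theta_0$ be the nonempty finite sets and $L^\theta_{n+1}$ the nonempty finite $X$ with $X\setminus\{\min X\}\in L^\theta_n\cdot(\min X,\dots,\min X)$ ($n+1$ entries). A set is $\omega^n$-large${}^*(\theta)$ if it lies in $L^\theta_n$. $X$ is $g$-sparse if $g(x)<y$ for all $x<y$ in $X$. A set $H$ is $f$-transitive if for every $i<2$ and $x<y<z$ in $H$, $f(x,y)=f(y,z)=i$ implies $f(x,z)=i$. *)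

theory Defs
  imports Main "HOL-Library.Ramsey"
begin

section \<open>Bounded formulas of arithmetic\<close>

datatype tm = Var nat | Zero | One | Add tm tm | Mul tm tm

primrec tm_val :: "(nat \<Rightarrow> nat) \<Rightarrow> tm \<Rightarrow> nat" where
  "tm_val e (Var v) = e v"
| "tm_val e Zero = 0"
| "tm_val e One = 1"
| "tm_val e (Add s t) = tm_val e s + tm_val e t"
| "tm_val e (Mul s t) = tm_val e s * tm_val e t"

primrec tm_vars :: "tm \<Rightarrow> nat set" where
  "tm_vars (Var v) = {v}"
| "tm_vars Zero = {}"
| "tm_vars One = {}"
| "tm_vars (Add s t) = tm_vars s \<union> tm_vars t"
| "tm_vars (Mul s t) = tm_vars s \<union> tm_vars t"

text \<open>\<open>BAll v t \<phi>\<close> is \<open>\<forall>v < t. \<phi>\<close> and \<open>BEx v t \<phi>\<close> is \<open>\<exists>v < t. \<phi>\<close>. An occurrence of \<open>v\<close> in the bound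
  \<open>t\<close> is not captured by the quantifier: \<open>t\<close> is evaluated in the outer environment. Hence the usual
  side condition that \<open>v\<close> does not occur in \<open>t\<close> can be met by renaming \<open>v\<close> and is not imposed.\<close>

datatype delta0 =
    Eq tm tm
  | Less tm tm
  | Neg delta0
  | Conj delta0 delta0
  | Disj delta0 delta0
  | Impl delta0 delta0
  | BAll nat tm delta0
  | BEx nat tm delta0

primrec holds :: "(nat \<Rightarrow> nat) \<Rightarrow> delta0 \<Rightarrow> bool" where
  "holds e (Eq s t) \<longleftrightarrow> tm_val e s = tm_val e t"
| "holds e (Less s t) \<longleftrightarrow> tm_val e s < tm_val e t"
| "holds e (Neg \<phi>) \<longleftrightarrow> \<not> holds e \<phi>"
| "holds e (Conj \<phi> \<psi>) \<longleftrightarrow> holds e \<phi> \<and> holds e \<psi>"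
| "holds e (Disj \<phi> \<psi>) \<longleftrightarrow> holds e \<phi> \<or> holds e \<psi>"
| "holds e (Impl \<phi> \<psi>) \<longleftrightarrow> (holds e \<phi> \<longrightarrow> holds e \<psi>)"
| "holds e (BAll v t \<phi>) \<longleftrightarrow> (\<forall>a < tm_val e t. holds (e(v := a)) \<phi>)"
| "holds e (BEx v t \<phi>) \<longleftrightarrow> (\<exists>a < tm_val e t. holds (e(v := a)) \<phi>)"

primrec free_vars :: "delta0 \<Rightarrow> nat set" where
  "free_vars (Eq s t) = tm_vars s \<union> tm_vars t"
| "free_vars (Less s t) = tm_vars s \<union> tm_vars t"
| "free_vars (Neg \<phi>) = free_vars \<phi>"
| "free_vars (Conj \<phi> \<psi>) = free_vars \<phi> \<union> free_vars \<psi>"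
| "free_vars (Disj \<phi> \<psi>) = free_vars \<phi> \<union> free_vars \<psi>"
| "free_vars (Impl \<phi> \<psi>) = free_vars \<phi> \<union> free_vars \<psi>"
| "free_vars (BAll v t \<phi>) = tm_vars t \<union> (free_vars \<phi> - {v})"
| "free_vars (BEx v t \<phi>) = tm_vars t \<union> (free_vars \<phi> - {v})"

text \<open>A formula \<open>\<theta>(x,y,z)\<close> has its free variables among \<open>0, 1, 2\<close>, which stand for \<open>x, y, z\<close>. The
  value \<open>0\<close> given to the other variables is then irrelevant.\<close>

definition rel3 :: "delta0 \<Rightarrow> nat \<Rightarrow> nat \<Rightarrow> nat \<Rightarrow> bool" where
  "rel3 \<theta> x y z \<longleftrightarrow> holds ((\<lambda>_. 0)(0 := x, 1 := y, 2 := z)) \<theta>"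


section \<open>Primitive recursive functions\<close>

text \<open>\<open>primrec_fun n f\<close>: \<open>f\<close>, restricted to lists of length \<open>n\<close>, is a primitive recursive function of
  \<open>n\<close> arguments. The recursion argument comes first.\<close>

inductive primrec_fun :: "nat \<Rightarrow> (nat list \<Rightarrow> nat) \<Rightarrow> bool" where
  zero: "primrec_fun n (\<lambda>_. 0)"
| succ: "primrec_fun 1 (\<lambda>xs. Suc (xs ! 0))"
| proj: "i < n \<Longrightarrow> primrec_fun n (\<lambda>xs. xs ! i)"
| comp: "primrec_fun (length gs) f \<Longrightarrow> (\<forall>g \<in> set gs. primrec_fun n g) \<Longrightarrow>
    primrec_fun n (\<lambda>xs. f (map (\<lambda>g. g xs) gs))"
| prec: "primrec_fun n f \<Longrightarrow> primrec_fun (Suc (Suc n)) g \<Longrightarrow>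
    primrec_fun (Suc n) (\<lambda>xs. rec_nat (f (tl xs)) (\<lambda>m r. g (m # r # tl xs)) (hd xs))"

definition primitive_recursive :: "(nat \<Rightarrow> nat) \<Rightarrow> bool" where
  "primitive_recursive g \<longleftrightarrow> (\<exists>f. primrec_fun 1 f \<and> (\<forall>x. g x = f [x]))"


section \<open>Largeness\<close>

definition set_less :: "nat set \<Rightarrow> nat set \<Rightarrow> bool" where
  "set_less A B \<longleftrightarrow> (\<forall>a \<in> A. \<forall>b \<in> B. a < b)"

text \<open>\<open>Max\<close> and \<open>Min\<close> of the empty set are unspecified, but empty sets are irrelevant in \<open>large\<close>
  below: the members of \<open>large \<theta> n\<close> are nonempty, so an empty set can only enter a product
  through a multiplicity \<open>0\<close>; there all multiplicities equal \<open>Min X\<close>, and if this is \<open>0\<close>, the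
  product consists of all finite sets and no two sets are ever compared.\<close>

definition apart :: "(nat \<Rightarrow> nat \<Rightarrow> nat \<Rightarrow> bool) \<Rightarrow> nat set \<Rightarrow> nat set \<Rightarrow> bool" where
  "apart \<theta> E F \<longleftrightarrow> (\<forall>x < Max E. \<exists>y < Min F. \<forall>z < Max F. \<theta> x y z)"

definition fam_mult ::
  "(nat \<Rightarrow> nat \<Rightarrow> nat \<Rightarrow> bool) \<Rightarrow> nat set set \<Rightarrow> nat \<Rightarrow> nat set set" where
  "fam_mult \<theta> L k = {F. finite F \<and> (\<exists>X :: nat \<Rightarrow> nat set.
     (\<forall>i < k. X i \<subseteq> F \<and> X i \<in> L) \<and>
     (\<forall>j < k. \<forall>i < j. set_less (X i) (X j) \<and> apart \<theta> (X i) (X j)))}"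

primrec fam_mults ::
  "(nat \<Rightarrow> nat \<Rightarrow> nat \<Rightarrow> bool) \<Rightarrow> nat set set \<Rightarrow> nat list \<Rightarrow> nat set set" where
  "fam_mults \<theta> L [] = L"
| "fam_mults \<theta> L (k # ks) = fam_mults \<theta> (fam_mult \<theta> L k) ks"

text \<open>\<open>large \<theta> n\<close> is the family of \<open>\<omega>\<close>-to-the-\<open>n\<close>-large* sets with respect to \<open>\<theta>\<close>.\<close>

primrec large :: "(nat \<Rightarrow> nat \<Rightarrow> nat \<Rightarrow> bool) \<Rightarrow> nat \<Rightarrow> nat set set" where
  "large \<theta> 0 = {X. finite X \<and> X \<noteq> {}}"
| "large \<theta> (Suc n) = {X. finite X \<and> X \<noteq> {} \<and>
     X - {Min X} \<in> fam_mults \<theta> (large \<theta> n) (replicate (Suc n) (Min X))}"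

definition sparse :: "(nat \<Rightarrow> nat) \<Rightarrow> nat set \<Rightarrow> bool" where
  "sparse g X \<longleftrightarrow> (\<forall>x \<in> X. \<forall>y \<in> X. x < y \<longrightarrow> g x < y)"

text \<open>Colourings of pairs are functions on two-element sets; \<open>f {x, y}\<close> with \<open>x < y\<close> is the
  \<open>f(x,y)\<close> of the usual notation.\<close>

definition transitive_for :: "(nat set \<Rightarrow> nat) \<Rightarrow> nat set \<Rightarrow> bool" where
  "transitive_for f H \<longleftrightarrow> (\<forall>i < 2. \<forall>x \<in> H. \<forall>y \<in> H. \<forall>z \<in> H. x < y \<and> y < z \<longrightarrow>
     f {x, y} = i \<and> f {y, z} = i \<longrightarrow> f {x, z} = i)"

definition EM_large :: "(nat \<Rightarrow> nat \<Rightarrow> nat \<Rightarrow> bool) \<Rightarrow> nat \<Rightarrow> nat set \<Rightarrow> bool" where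
  "EM_large \<theta> n X \<longleftrightarrow> (\<forall>f \<in> [X]\<^bsup>2\<^esup> \<rightarrow> {..<2}.
     \<exists>H \<subseteq> X. transitive_for f H \<and> H \<in> large \<theta> n)"

end

theory Submission
  imports Defs
begin

text \<open>An \<open>\<omega>\<close>-to-the-\<open>(n+1)\<close>-large set is its minimum followed by a tree of depth \<open>n + 1\<close> whose
  branching is that minimum and whose leaves are \<open>\<omega>\<close>-to-the-\<open>n\<close>-large; siblings are apart. The proof
  is by induction on \<open>k\<close>, each step spending six exponents. Let \<open>x\<close> be the minimum of the set.
  Among the first leaves, pick \<open>A < B\<close> (if \<open>x = 1\<close>, there is only one leaf, but then one leaf
  suffices). Sparsity makes the branching of \<open>B\<close> large compared with \<open>Max A\<close>, which bounds \<open>x\<close> and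
  \<open>k\<close>, so \<open>B\<close> contains a tree of depth \<open>k + 1\<close> with sufficient branching but fewer leaves than the
  logarithm of \<open>Min B\<close>. Two applications of a pigeonhole principle, each costing two exponents, thin
  the leaves until the colour of a pair of elements of different leaves depends on the two leaves
  only. A Ramsey theorem for finite trees then gives a subtree of branching at least \<open>x\<close> in which, at
  each node, all pairs from different children have the same colour. Such a subtree is transitive as
  soon as each of its leaves is, which the induction hypothesis achieves.\<close>

section \<open>Primitive recursive bounds\<close>

text \<open>\<open>primrec_fun\<close> speaks of functions on lists of every length. Allowing
  agreement on lists of length \<open>n\<close> only lets explicit terms be handled without regard
  to their other values.\<close>

definition computable_by :: "nat \<Rightarrow> (nat list \<Rightarrow> nat) \<Rightarrow> bool" where
  "computable_by n F \<longleftrightarrow> (\<exists>f. primrec_fun n f \<and> (\<forall>xs. length xs = n \<longrightarrow> f xs = F xs))"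

lemma computable_by_cong:
  assumes "computable_by n F" "\<And>xs. length xs = n \<Longrightarrow> F xs = G xs"
  shows "computable_by n G"
  using assms unfolding computable_by_def by metis

lemma computable_by_primrec_fun: "primrec_fun n f \<Longrightarrow> computable_by n f"
  unfolding computable_by_def by blast

lemma computable_by_comp:
  assumes F: "computable_by (length Gs) F" and G: "\<forall>G \<in> set Gs. computable_by n G"
  shows "computable_by n (\<lambda>xs. F (map (\<lambda>G. G xs) Gs))"
proof -
  obtain f where f: "primrec_fun (length Gs) f" "\<forall>xs. length xs = length Gs \<longrightarrow> f xs = F xs"
    using F unfolding computable_by_def by blast
  obtain h where h: "\<forall>G \<in> set Gs. primrec_fun n (h G) \<and> (\<forall>xs. length xs = n \<longrightarrow> h G xs = G xs)"
    using bchoice[OF G[unfolded computable_by_def]] by blast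
  have "primrec_fun n (\<lambda>xs. f (map (\<lambda>g. g xs) (map h Gs)))"
    by (rule primrec_fun.comp) (use f h in auto)
  moreover have "f (map (\<lambda>g. g xs) (map h Gs)) = F (map (\<lambda>G. G xs) Gs)" if "length xs = n" for xs
  proof -
    have "map (\<lambda>g. g xs) (map h Gs) = map (\<lambda>G. G xs) Gs"
      using h that by simp
    then show ?thesis by (metis f(2) length_map)
  qed
  ultimately show ?thesis unfolding computable_by_def by blast
qed

lemma computable_by_prec:
  assumes "computable_by n F" "computable_by (Suc (Suc n)) G"
  shows "computable_by (Suc n) (\<lambda>xs. rec_nat (F (tl xs)) (\<lambda>m r. G (m # r # tl xs)) (hd xs))"
proof -
  obtain f where f: "primrec_fun n f" "\<forall>xs. length xs = n \<longrightarrow> f xs = F xs"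
    using assms(1) unfolding computable_by_def by blast
  obtain g where g: "primrec_fun (Suc (Suc n)) g" "\<forall>xs. length xs = Suc (Suc n) \<longrightarrow> g xs = G xs"
    using assms(2) unfolding computable_by_def by blast
  show ?thesis unfolding computable_by_def
    using primrec_fun.prec[OF f(1) g(1)] f(2) g(2) by (intro exI conjI) auto
qed

definition computable_by2 :: "(nat \<Rightarrow> nat \<Rightarrow> nat) \<Rightarrow> bool" where
  "computable_by2 h \<longleftrightarrow> computable_by 2 (\<lambda>xs. h (xs ! 0) (xs ! 1))"

lemma computable_by_binary:
  assumes "computable_by2 h" "computable_by n F" "computable_by n G"
  shows "computable_by n (\<lambda>xs. h (F xs) (G xs))"
  using computable_by_comp[of "[F, G]" "\<lambda>xs. h (xs ! 0) (xs ! 1)" n] assms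
  by (simp add: computable_by2_def numeral_2_eq_2)

lemma computable_by_proj: "i < n \<Longrightarrow> computable_by n (\<lambda>xs. xs ! i)"
  by (intro computable_by_primrec_fun primrec_fun.proj)

lemma computable_by_Suc:
  assumes "computable_by n F"
  shows "computable_by n (\<lambda>xs. Suc (F xs))"
  using computable_by_comp[of "[F]" "\<lambda>xs. Suc (xs ! 0)" n] assms
    computable_by_primrec_fun[OF primrec_fun.succ] by simp

lemma computable_by_const: "computable_by n (\<lambda>_. c)"
proof (induction c)
  case 0
  then show ?case by (intro computable_by_primrec_fun primrec_fun.zero)
next
  case (Suc c)
  then show ?case by (rule computable_by_Suc)
qed

text \<open>The scheme \<open>prec\<close> hands its step the list \<open>m # r # tl xs\<close>, so
  the previous value and the parameter sit at positions 1 and 2. The recursion argument is the first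
  one, which fixes the argument order in the instances below.\<close>

lemma computable_by2_rec:
  assumes "computable_by 1 (\<lambda>xs. F (xs ! 0))" "computable_by 3 (\<lambda>xs. G (xs ! 1) (xs ! 2))"
    and "\<And>x. h 0 x = F x" "\<And>n x. h (Suc n) x = G (h n x) x"
  shows "computable_by2 h"
proof -
  have h: "rec_nat (F x) (\<lambda>m r. G r x) n = h n x" for n x
    by (induction n) (simp_all add: assms)
  have "computable_by 2 (\<lambda>xs. rec_nat (F (tl xs ! 0)) (\<lambda>m r. G r (tl xs ! 0)) (hd xs))"
    using computable_by_prec[of 1 "\<lambda>xs. F (xs ! 0)" "\<lambda>xs. G (xs ! 1) (xs ! 2)"] assms(1,2)
    by (simp add: numeral_3_eq_3 numeral_2_eq_2)
  then show ?thesis unfolding computable_by2_def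
    by (rule computable_by_cong) (auto simp: h length_Suc_conv numeral_2_eq_2)
qed

lemma computable_by2_add: "computable_by2 (+)"
  by (rule computable_by2_rec[of "\<lambda>x. x" "\<lambda>r x. Suc r"])
    (auto intro!: computable_by_proj computable_by_Suc)

lemma computable_by2_mult: "computable_by2 (*)"
  by (rule computable_by2_rec[of "\<lambda>x. 0" "\<lambda>r x. x + r"])
    (auto intro!: computable_by_proj computable_by_const computable_by_binary[OF computable_by2_add])

lemma computable_by2_power: "computable_by2 (\<lambda>n x. x ^ n)"
  by (rule computable_by2_rec[of "\<lambda>x. 1" "\<lambda>r x. x * r"])
    (auto intro!: computable_by_proj computable_by_const[of _ "Suc 0", simplified]
      computable_by_binary[OF computable_by2_mult])

text \<open>In the step, \<open>q = 2 * tree_bound p n\<close> is the branching of a subtree with at most \<open>q ^ p\<close> elements,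
  towards which there are at most \<open>2 ^ (q ^ p)\<close> colourings; \<open>2 * p\<close> such subtrees are chosen in turn.\<close>

primrec tree_bound :: "nat \<Rightarrow> nat \<Rightarrow> nat" where
  "tree_bound p 0 = p"
| "tree_bound p (Suc n) =
    (2 * tree_bound p n * (2 * tree_bound p n) * 2 ^ ((2 * tree_bound p n) ^ p)) ^ (2 * p)"

text \<open>In the step the depth \<open>Suc k\<close> is at most \<open>p\<close>, so the diagonal
  value \<open>tree_bound p p\<close> serves all \<open>k\<close> at once. The result bounds the
  number of sets of leaves of a tree with twice the Ramsey branching; the doubling is spent on the
  colour towards the root.\<close>

definition growth :: "nat \<Rightarrow> nat" where
  "growth p = 2 ^ ((2 * tree_bound p p) ^ p)"

lemma computable_by2_tree_bound: "computable_by2 (\<lambda>n p. tree_bound p n)"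
  by (rule computable_by2_rec[of "\<lambda>x. x" "\<lambda>r p. (2 * r * (2 * r) * 2 ^ ((2 * r) ^ p)) ^ (2 * p)"])
    (auto intro!: computable_by_proj computable_by_const computable_by_binary[OF computable_by2_mult]
      computable_by_binary[OF computable_by2_power])

lemma primitive_recursive_growth: "primitive_recursive growth"
proof -
  have "computable_by 1 (\<lambda>xs. growth (xs ! 0))"
    unfolding growth_def
    by (auto intro!: computable_by_proj computable_by_const computable_by_binary[OF computable_by2_mult]
      computable_by_binary[OF computable_by2_power] computable_by_binary[OF computable_by2_tree_bound])
  then obtain f where "primrec_fun 1 f" "\<forall>xs. length xs = 1 \<longrightarrow> f xs = growth (xs ! 0)"
    unfolding computable_by_def by blast
  then show ?thesis unfolding primitive_recursive_def by (intro exI[of _ f]) simp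
qed

section \<open>Estimates for the growth function\<close>

lemma tree_bound_mono:
  assumes "0 < p" "m \<le> n"
  shows "tree_bound p m \<le> tree_bound p n"
proof (rule lift_Suc_mono_le[OF _ assms(2)])
  fix n
  let ?t = "tree_bound p n"
  let ?v = "2 * ?t * (2 * ?t) * 2 ^ ((2 * ?t) ^ p)"
  have "?t \<le> ?v"
  proof (cases "?t = 0")
    case False
    then have "?t * 1 \<le> ?t * (2 * (2 * ?t) * 2 ^ ((2 * ?t) ^ p))"
      by (intro mult_left_mono) auto
    then show ?thesis by (simp add: algebra_simps)
  qed simp
  also have "?v \<le> ?v ^ (2 * p)"
    using self_le_power[of ?v "2 * p"] assms(1) by (cases "?v = 0") auto
  finally show "?t \<le> tree_bound p (Suc n)" by simp
qed

lemma le_tree_bound: "0 < p \<Longrightarrow> p \<le> tree_bound p n"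
  using tree_bound_mono[of p 0 n] by simp

lemma growth_lower_bound:
  assumes "0 < p"
  shows "2 ^ (2 * p) \<le> growth p"
proof -
  have "2 * p \<le> 2 * tree_bound p p" using le_tree_bound[OF assms] by simp
  also have "\<dots> \<le> (2 * tree_bound p p) ^ p"
    using self_le_power[of "2 * tree_bound p p" p] le_tree_bound[OF assms, of p] assms by simp
  finally show ?thesis unfolding growth_def by (simp add: power_increasing)
qed

lemma square_le_growth:
  assumes "0 < p"
  shows "p * p \<le> growth p"
proof -
  have "p * p \<le> 2 ^ p * 2 ^ p" by (intro mult_mono) auto
  also have "\<dots> = 2 ^ (2 * p)" by (simp add: mult_2 power_add)
  finally show ?thesis using growth_lower_bound[OF assms] by linarith
qed

section \<open>Trees of sets\<close>

text \<open>The relation is a parameter because two kinds of trees occur: trees of numbers with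
  \<open>sep\<close>, and trees whose points are whole leaves, with
  \<open>Union_rel\<close>.\<close>

definition gmult :: "('a set \<Rightarrow> 'a set \<Rightarrow> bool) \<Rightarrow> 'a set set \<Rightarrow> nat \<Rightarrow> 'a set set" where
  "gmult r L k = {F. finite F \<and> (\<exists>X :: nat \<Rightarrow> 'a set.
     (\<forall>i < k. X i \<subseteq> F \<and> X i \<in> L) \<and> (\<forall>j < k. \<forall>i < j. r (X i) (X j)))}"

primrec gtree :: "('a set \<Rightarrow> 'a set \<Rightarrow> bool) \<Rightarrow> 'a set set \<Rightarrow> nat \<Rightarrow> nat \<Rightarrow> 'a set set" where
  "gtree r L b 0 = L"
| "gtree r L b (Suc n) = gmult r (gtree r L b n) b"

text \<open>Thinning a tree replaces siblings by subsets; this property keeps them related.\<close>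

definition hereditary :: "('a set \<Rightarrow> 'a set \<Rightarrow> bool) \<Rightarrow> bool" where
  "hereditary r \<longleftrightarrow> (\<forall>A B A' B'. r A B \<and> A' \<subseteq> A \<and> B' \<subseteq> B \<longrightarrow> r A' B')"

lemma gmultI:
  fixes J :: "nat set"
  assumes "finite F" "finite J" "k \<le> card J" "\<And>j. j \<in> J \<Longrightarrow> X j \<subseteq> F \<and> X j \<in> L"
    and "\<And>i j. i \<in> J \<Longrightarrow> j \<in> J \<Longrightarrow> i < j \<Longrightarrow> r (X i) (X j)"
  shows "F \<in> gmult r L k"
proof -
  \<comment> \<open>Multiplicity \<open>k\<close> asks for indices below \<open>k\<close>; the
    increasing enumeration of \<open>J\<close> supplies them in the right order.\<close>
  define js where "js = sorted_list_of_set J"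
  have len: "length js = card J" and set: "set js = J" and sd: "sorted_wrt (<) js"
    using assms(2) by (auto simp: js_def)
  have in_J: "js ! i \<in> J" if "i < k" for i
    using that assms(3) len set nth_mem by fastforce
  have less: "js ! i < js ! j" if "i < j" "j < k" for i j
    using sd that assms(3) len sorted_wrt_nth_less by fastforce
  show ?thesis unfolding gmult_def
    using assms(1,4,5) in_J less by (auto intro!: exI[of _ "\<lambda>i. X (js ! i)"])
qed

lemma gmultE:
  assumes "F \<in> gmult r L k"
  obtains X :: "nat \<Rightarrow> 'a set" where "finite F" "\<And>i. i < k \<Longrightarrow> X i \<subseteq> F \<and> X i \<in> L"
    "\<And>i j. i < j \<Longrightarrow> j < k \<Longrightarrow> r (X i) (X j)"
  using assms unfolding gmult_def by blast

lemma gmult_mono: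
  assumes "L \<subseteq> L'" "k' \<le> k"
  shows "gmult r L k \<subseteq> gmult r L' k'"
proof
  fix F assume "F \<in> gmult r L k"
  then show "F \<in> gmult r L' k'"
  proof (rule gmultE)
    fix X :: "nat \<Rightarrow> _"
    assume X: "finite F" "\<And>i. i < k \<Longrightarrow> X i \<subseteq> F \<and> X i \<in> L"
      "\<And>i j. i < j \<Longrightarrow> j < k \<Longrightarrow> r (X i) (X j)"
    show ?thesis
      by (rule gmultI[where J = "{..<k'}" and X = X]) (use X assms in auto)
  qed
qed

lemma gtree_mono: "b' \<le> b \<Longrightarrow> gtree r L b n \<subseteq> gtree r L b' n"
  by (induction n) (simp_all add: gmult_mono)

text \<open>\<open>gtree\<close> adds levels at the root, \<open>fam_mults\<close> at the leaves;
  for constant branching both orders give the same trees.\<close>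

lemma gtree_gmult: "gtree r (gmult r L b) b n = gtree r L b (Suc n)"
  by (induction n) simp_all

lemma gtree_add: "gtree r L b (m + n) = gtree r (gtree r L b m) b n"
  by (induction n) simp_all

lemma finite_gtree: "F \<in> gtree r L b n \<Longrightarrow> (\<And>Z. Z \<in> L \<Longrightarrow> finite Z) \<Longrightarrow> finite F"
  by (cases n) (auto elim: gmultE)

lemma gtree_leaf:
  assumes "F \<in> gtree r L b n" "0 < b"
  shows "\<exists>Z \<subseteq> F. Z \<in> L"
  using assms(1)
proof (induction n arbitrary: F)
  case (Suc n)
  obtain X where "\<And>i. i < b \<Longrightarrow> X i \<subseteq> F \<and> X i \<in> gtree r L b n"
    using Suc.prems unfolding gtree.simps by (rule gmultE) (rule that, blast)
  with assms(2) have "X 0 \<subseteq> F" "X 0 \<in> gtree r L b n" by auto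
  then show ?case using Suc.IH by (meson order_trans)
qed auto

lemma gtree_gmult_subset:
  assumes "F \<in> gtree r L b (Suc n)" "0 < b"
  shows "\<exists>Z \<subseteq> F. Z \<in> gmult r L b"
  using gtree_leaf[of F r "gmult r L b" b n] assms by (simp add: gtree_gmult del: gtree.simps)

text \<open>Follow one branch down through the top \<open>n - m\<close> levels.\<close>

lemma gtree_shallow:
  assumes "F \<in> gtree r L b n" "0 < b" "m \<le> n"
  shows "\<exists>Z \<subseteq> F. Z \<in> gtree r L b m"
  using gtree_leaf[of F r "gtree r L b m" b "n - m"] assms by (simp flip: gtree_add)

lemma gtree_one:
  assumes "Z \<in> L" "finite Z"
  shows "Z \<in> gtree r L (Suc 0) n"
proof (induction n)
  case (Suc n)
  then show ?case using assms(2) by (auto simp: gmult_def intro!: exI[of _ "\<lambda>_. Z"])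
qed (use assms in simp)

text \<open>Work from the leaves upwards: once every child of a node is thinned to one colour, some
  colour is shared by at least \<open>h\<close> of the \<open>b\<close> children, and these are
  kept. The depth is preserved; the branching is divided by the number of colours.\<close>

lemma gtree_pigeonhole:
  assumes r: "hereditary r" and C: "finite C" "C \<noteq> {}"
    and leaf: "\<And>Z. Z \<in> M \<Longrightarrow> Z \<subseteq> F \<Longrightarrow> \<exists>i \<in> C. \<exists>Z' \<subseteq> Z. Z' \<in> M' \<and> col ` Z' \<subseteq> {i}"
    and F: "F \<in> gtree r M b n" and b: "h * card C \<le> b"
  shows "\<exists>i \<in> C. \<exists>F' \<subseteq> F. F' \<in> gtree r M' h n \<and> col ` F' \<subseteq> {i}"
  using leaf F
proof (induction n arbitrary: F)
  case 0
  then show ?case by auto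
next
  case (Suc n)
  obtain X where X: "finite F" "\<And>i. i < b \<Longrightarrow> X i \<subseteq> F \<and> X i \<in> gtree r M b n"
      "\<And>i j. i < j \<Longrightarrow> j < b \<Longrightarrow> r (X i) (X j)"
    using Suc.prems(2) unfolding gtree.simps by (rule gmultE) (rule that)
  have "\<forall>j \<in> {..<b}. \<exists>i F'. i \<in> C \<and> F' \<subseteq> X j \<and> F' \<in> gtree r M' h n \<and> col ` F' \<subseteq> {i}"
  proof
    fix j assume "j \<in> {..<b}"
    then have "X j \<subseteq> F" "X j \<in> gtree r M b n" using X(2) by auto
    then show "\<exists>i F'. i \<in> C \<and> F' \<subseteq> X j \<and> F' \<in> gtree r M' h n \<and> col ` F' \<subseteq> {i}"
      using Suc.IH[of "X j"] Suc.prems(1) by (meson order_trans)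
  qed
  from bchoice[OF this] obtain c where "\<forall>j \<in> {..<b}. \<exists>F'. c j \<in> C \<and> F' \<subseteq> X j \<and>
      F' \<in> gtree r M' h n \<and> col ` F' \<subseteq> {c j}" by blast
  from bchoice[OF this] obtain Y where cY: "\<And>j. j < b \<Longrightarrow> c j \<in> C \<and> Y j \<subseteq> X j \<and>
      Y j \<in> gtree r M' h n \<and> col ` Y j \<subseteq> {c j}" by auto
  obtain i where i: "i \<in> C" "card {..<b} \<le> card (c -` {i} \<inter> {..<b}) * card C"
    using pigeonhole_card[of c "{..<b}" C] C cY by auto
  define J where "J = c -` {i} \<inter> {..<b}"
  have "h * card C \<le> card J * card C" using i(2) b unfolding J_def card_lessThan by linarith
  then have J: "h \<le> card J" using C by (simp add: card_gt_0_iff)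
  define F' where "F' = (\<Union>j \<in> J. Y j)"
  have F': "F' \<subseteq> F" unfolding F'_def J_def using X(2) cY by blast
  have "F' \<in> gmult r (gtree r M' h n) h"
  proof (rule gmultI[where J = J and X = Y])
    show "finite F'" using F' X(1) finite_subset by blast
    show "finite J" "h \<le> card J" by (simp_all add: J_def J[unfolded J_def])
    show "Y j \<subseteq> F' \<and> Y j \<in> gtree r M' h n" if "j \<in> J" for j
      using that cY by (auto simp: F'_def J_def)
    show "r (Y k) (Y j)" if "k \<in> J" "j \<in> J" "k < j" for k j
    proof -
      have "r (X k) (X j)" "Y k \<subseteq> X k" "Y j \<subseteq> X j" using that X(3) cY by (auto simp: J_def)
      then show ?thesis using r unfolding hereditary_def by blast
    qed
  qed
  moreover have "col ` F' \<subseteq> {i}" using cY by (fastforce simp: F'_def J_def)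
  ultimately show ?case using i(1) F' by auto
qed

lemma gtree_pigeonhole_elements:
  assumes "hereditary r" "finite C" "C \<noteq> {}" and col: "col ` F \<subseteq> C"
    and "F \<in> gtree r (range (\<lambda>x. {x})) b n" "h * card C \<le> b"
  shows "\<exists>i \<in> C. \<exists>F' \<subseteq> F. F' \<in> gtree r (range (\<lambda>x. {x})) h n \<and> col ` F' \<subseteq> {i}"
proof (rule gtree_pigeonhole[OF assms(1-3) _ assms(5,6)])
  fix Z :: "'a set"
  assume "Z \<in> range (\<lambda>x. {x})" "Z \<subseteq> F"
  then obtain x where "Z = {x}" "col x \<in> C" using col by auto
  then show "\<exists>i \<in> C. \<exists>Z' \<subseteq> Z. Z' \<in> range (\<lambda>x. {x}) \<and> col ` Z' \<subseteq> {i}"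
    by (intro bexI[of _ "col x"] exI[of _ Z]) auto
qed

text \<open>Passing from a tree to the set of its leaves turns a statement about unions of leaves into one
  about a tree with finitely many elements, whose number is bounded.\<close>

definition Union_rel :: "('a set \<Rightarrow> 'a set \<Rightarrow> bool) \<Rightarrow> 'a set set \<Rightarrow> 'a set set \<Rightarrow> bool" where
  "Union_rel r A B \<longleftrightarrow> r (\<Union>A) (\<Union>B)"

lemma hereditary_Union_rel: "hereditary r \<Longrightarrow> hereditary (Union_rel r)"
  unfolding hereditary_def Union_rel_def by (meson Union_mono)

lemma card_UN_le_mult:
  assumes "\<And>i. i < b \<Longrightarrow> card (R i) \<le> s"
  shows "card (\<Union>i<b. R i) \<le> b * s"
proof -
  have "card (\<Union>i<b. R i) \<le> (\<Sum>i<b. card (R i))" by (rule card_UN_le) simp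
  also have "\<dots> \<le> (\<Sum>i<b. s)" by (rule sum_mono) (use assms in simp)
  finally show ?thesis by simp
qed

text \<open>Keeping only \<open>b\<close> children at each node gives the bound
  \<open>b ^ n\<close>. The kept leaves need not exhaust a node, so the relation between siblings
  reaches their unions by heredity.\<close>

lemma gtree_leaves:
  assumes "hereditary r" "F \<in> gtree r M b n"
  shows "\<exists>R. finite R \<and> card R \<le> b ^ n \<and> R \<in> gtree (Union_rel r) (range (\<lambda>x. {x})) b n \<and>
    (\<forall>Z \<in> R. Z \<in> M \<and> Z \<subseteq> F)"
  using assms(2)
proof (induction n arbitrary: F)
  case 0
  then show ?case by (intro exI[of _ "{F}"]) auto
next
  case (Suc n)
  obtain X where X: "finite F" "\<And>i. i < b \<Longrightarrow> X i \<subseteq> F \<and> X i \<in> gtree r M b n"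
      "\<And>i j. i < j \<Longrightarrow> j < b \<Longrightarrow> r (X i) (X j)"
    using Suc.prems unfolding gtree.simps by (rule gmultE) (rule that)
  have "\<forall>i \<in> {..<b}. \<exists>R. finite R \<and> card R \<le> b ^ n \<and>
      R \<in> gtree (Union_rel r) (range (\<lambda>x. {x})) b n \<and> (\<forall>Z \<in> R. Z \<in> M \<and> Z \<subseteq> X i)"
    using X(2) Suc.IH by simp
  from bchoice[OF this] obtain R where R: "\<And>i. i < b \<Longrightarrow> finite (R i) \<and> card (R i) \<le> b ^ n \<and>
      R i \<in> gtree (Union_rel r) (range (\<lambda>x. {x})) b n \<and> (\<forall>Z \<in> R i. Z \<in> M \<and> Z \<subseteq> X i)" by auto
  let ?R = "\<Union>i<b. R i"
  have "?R \<in> gmult (Union_rel r) (gtree (Union_rel r) (range (\<lambda>x. {x})) b n) b"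
  proof (rule gmultI[where J = "{..<b}" and X = R])
    show "Union_rel r (R i) (R j)" if "i \<in> {..<b}" "j \<in> {..<b}" "i < j" for i j
    proof -
      have "i < b" "j < b" using that by simp_all
      then have "r (X i) (X j)" "\<Union>(R i) \<subseteq> X i" "\<Union>(R j) \<subseteq> X j"
        using that(3) X(3) R by (simp_all add: Sup_le_iff)
      then show ?thesis using assms(1) unfolding Union_rel_def hereditary_def by blast
    qed
  qed (use R in auto)
  moreover have "card ?R \<le> b * b ^ n" by (rule card_UN_le_mult) (use R in auto)
  moreover have "\<forall>Z \<in> ?R. Z \<in> M \<and> Z \<subseteq> F" using R X(2) by fastforce
  ultimately show ?case using R by (intro exI[of _ ?R]) auto
qed

text \<open>A bound on the number of points bounds the number of colour patterns towards them, which
  a pigeonhole over \<open>Pow Q\<close> requires.\<close>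

lemma gtree_small:
  assumes r: "hereditary r" and "F \<in> gtree r (range (\<lambda>x. {x})) b n"
  shows "\<exists>Q \<subseteq> F. finite Q \<and> card Q \<le> b ^ n \<and> Q \<in> gtree r (range (\<lambda>x. {x})) b n"
  using assms(2)
proof (induction n arbitrary: F)
  case 0
  then show ?case by (intro exI[of _ F]) auto
next
  case (Suc n)
  obtain X where X: "finite F" "\<And>i. i < b \<Longrightarrow> X i \<subseteq> F \<and> X i \<in> gtree r (range (\<lambda>x. {x})) b n"
      "\<And>i j. i < j \<Longrightarrow> j < b \<Longrightarrow> r (X i) (X j)"
    using Suc.prems unfolding gtree.simps by (rule gmultE) (rule that)
  have "\<forall>i \<in> {..<b}. \<exists>Q. Q \<subseteq> X i \<and> finite Q \<and> card Q \<le> b ^ n \<and>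
      Q \<in> gtree r (range (\<lambda>x. {x})) b n"
    using X(2) Suc.IH by simp
  from bchoice[OF this] obtain Q where Q: "\<And>i. i < b \<Longrightarrow> Q i \<subseteq> X i \<and> finite (Q i) \<and>
      card (Q i) \<le> b ^ n \<and> Q i \<in> gtree r (range (\<lambda>x. {x})) b n" by auto
  let ?Q = "\<Union>i<b. Q i"
  have "?Q \<in> gmult r (gtree r (range (\<lambda>x. {x})) b n) b"
  proof (rule gmultI[where J = "{..<b}" and X = Q])
    show "r (Q i) (Q j)" if "i \<in> {..<b}" "j \<in> {..<b}" "i < j" for i j
    proof -
      have "r (X i) (X j)" "Q i \<subseteq> X i" "Q j \<subseteq> X j" using that X(3) Q by simp_all
      then show ?thesis using r unfolding hereditary_def by blast
    qed
  qed (use Q in auto)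
  moreover have "card ?Q \<le> b * b ^ n" by (rule card_UN_le_mult) (use Q in auto)
  moreover have "?Q \<subseteq> F" using Q X(2) by blast
  ultimately show ?case using Q by (intro exI[of _ ?Q]) auto
qed

section \<open>A Ramsey theorem for trees\<close>

text \<open>Unlike in \<open>gmult\<close>, \<open>F\<close> is exactly the union of its children,
  so the colour condition reaches every pair from different children. The colour \<open>c\<close>
  may vary from node to node.\<close>

primrec homogeneous_trees :: "('a set \<Rightarrow> 'a set \<Rightarrow> bool) \<Rightarrow> ('a \<Rightarrow> 'a \<Rightarrow> bool) \<Rightarrow> nat \<Rightarrow> nat \<Rightarrow> 'a set set" where
  "homogeneous_trees r f a 0 = range (\<lambda>x. {x})"
| "homogeneous_trees r f a (Suc n) = {F. \<exists>(J :: nat set) X c. finite J \<and> a \<le> card J \<and> F = (\<Union>j \<in> J. X j) \<and>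
     (\<forall>j \<in> J. X j \<in> homogeneous_trees r f a n) \<and>
     (\<forall>i \<in> J. \<forall>j \<in> J. i < j \<longrightarrow> r (X i) (X j) \<and> (\<forall>x \<in> X i. \<forall>y \<in> X j. f x y = c))}"

text \<open>The trees are treated from left to right. A small subtree of the first one is fixed, the
  remaining trees are thinned until each of its elements has only one colour towards all of them, and
  then the subtree is thinned until this colour does not depend on the element.\<close>

lemma end_homogeneous_trees:
  fixes f :: "'a \<Rightarrow> 'a \<Rightarrow> bool" and J :: "nat set"
  assumes r: "hereditary r"
    and ramsey: "\<And>R. R \<in> gtree r (range (\<lambda>x. {x})) t n \<Longrightarrow> \<exists>H \<subseteq> R. H \<in> homogeneous_trees r f a n"
    and t: "0 < t" and W: "(2 * t) ^ n \<le> e" and V: "V = 2 * t * (2 * t) * 2 ^ e"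
    and "finite J" "V ^ m \<le> card J" "\<And>j. j \<in> J \<Longrightarrow> R j \<in> gtree r (range (\<lambda>x. {x})) (V ^ m) n"
  shows "\<exists>J' H \<kappa>. J' \<subseteq> J \<and> card J' = m \<and> (\<forall>j \<in> J'. H j \<subseteq> R j \<and> H j \<in> homogeneous_trees r f a n) \<and>
    (\<forall>i \<in> J'. \<forall>j \<in> J'. i < j \<longrightarrow> (\<forall>x \<in> H i. \<forall>y \<in> H j. f x y = \<kappa> i))"
  using assms(6-8)
proof (induction m arbitrary: J R)
  case 0
  show ?case by (intro exI[of _ "{}"]) simp
next
  case (Suc m)
  let ?S = "range (\<lambda>x. {x}) :: 'a set set"
  have V4: "2 * 2 ^ e \<le> V"
  proof -
    have "1 * 2 \<le> (2 * t) * (2 * t)" using t by (intro mult_mono) auto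
    then show ?thesis unfolding V by (intro mult_right_mono) auto
  qed
  have tV: "2 * t \<le> V"
  proof -
    have "2 * t * 1 \<le> 2 * t * (2 * t * 2 ^ e)" using t by (intro mult_left_mono) auto
    then show ?thesis unfolding V by (simp add: mult.assoc)
  qed
  have V0: "0 < V" using t V by simp
  then have Vm: "1 \<le> V ^ m" by simp
  define j0 where "j0 = Min J"
  have "J \<noteq> {}" using Suc.prems(2) V0 by (metis card.empty not_le zero_less_power)
  then have j0: "j0 \<in> J" "\<And>j. j \<in> J - {j0} \<Longrightarrow> j0 < j"
    using Suc.prems(1) unfolding j0_def by (auto simp: le_neq_implies_less)
  have "2 * t \<le> V ^ Suc m" using mult_mono[OF tV Vm] by simp
  then have "R j0 \<in> gtree r ?S (2 * t) n" using Suc.prems(3)[OF j0(1)] gtree_mono by blast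
  then obtain Q where Q: "Q \<subseteq> R j0" "finite Q" "card Q \<le> (2 * t) ^ n" "Q \<in> gtree r ?S (2 * t) n"
    using gtree_small[OF r] by blast
  have Pow_le: "card (Pow Q) \<le> 2 ^ e"
    using Q(2,3) W by (simp add: card_Pow power_increasing)
  define col where "col y = {x \<in> Q. f x y}" for y
  have bound: "V ^ m * card (Pow Q) \<le> V ^ Suc m"
  proof -
    have "V ^ m * card (Pow Q) \<le> V ^ m * V"
      using Pow_le V4 by (intro mult_left_mono) auto
    then show ?thesis by (simp add: mult.commute)
  qed
  \<comment> \<open>Two pigeonholes on the pattern towards \<open>Q\<close> follow: inside each
    tree, leaving one pattern \<open>C j\<close>, and then over the indices, leaving a common
    pattern \<open>D\<close>.\<close>
  have "\<forall>j \<in> J. \<exists>C. \<exists>F'. C \<in> Pow Q \<and> F' \<subseteq> R j \<and> F' \<in> gtree r ?S (V ^ m) n \<and> col ` F' \<subseteq> {C}"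
  proof
    fix j assume "j \<in> J"
    have "\<exists>C \<in> Pow Q. \<exists>F' \<subseteq> R j. F' \<in> gtree r ?S (V ^ m) n \<and> col ` F' \<subseteq> {C}"
      by (rule gtree_pigeonhole_elements[OF r _ _ _ Suc.prems(3)[OF \<open>j \<in> J\<close>] bound])
        (use Q in \<open>auto simp: col_def\<close>)
    then show "\<exists>C. \<exists>F'. C \<in> Pow Q \<and> F' \<subseteq> R j \<and> F' \<in> gtree r ?S (V ^ m) n \<and> col ` F' \<subseteq> {C}"
      by blast
  qed
  from bchoice[OF this] obtain C where "\<forall>j \<in> J. \<exists>F'. C j \<in> Pow Q \<and> F' \<subseteq> R j \<and>
      F' \<in> gtree r ?S (V ^ m) n \<and> col ` F' \<subseteq> {C j}" ..
  from bchoice[OF this] obtain R' where R': "\<forall>j \<in> J. C j \<in> Pow Q \<and> R' j \<subseteq> R j \<and>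
      R' j \<in> gtree r ?S (V ^ m) n \<and> col ` R' j \<subseteq> {C j}" ..
  define J1 where "J1 = J - {j0}"
  have "C \<in> J1 \<rightarrow> Pow Q" using R' by (auto simp: J1_def)
  then obtain D where D: "D \<in> Pow Q" "card J1 \<le> card (C -` {D} \<inter> J1) * card (Pow Q)"
    using pigeonhole_card[of C J1 "Pow Q"] Suc.prems(1) Q(2) by (auto simp: J1_def)
  define J2 where "J2 = C -` {D} \<inter> J1"
  have J2: "J2 \<subseteq> J" "finite J2" "j0 \<notin> J2" using Suc.prems(1) by (auto simp: J2_def J1_def)
  \<comment> \<open>One factor \<open>V\<close>, which is at least \<open>2 * 2 ^ e\<close>, pays
    both for the pigeonhole over the patterns and for the loss of \<open>j0\<close>.\<close>
  have "V ^ m \<le> card J2"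
  proof (rule ccontr)
    assume "\<not> V ^ m \<le> card J2"
    then have "card J2 + 1 \<le> V ^ m" by simp
    then have "(card J2 + 1) * 2 ^ e \<le> V ^ m * 2 ^ e" by (rule mult_right_mono) simp
    moreover have "card J1 \<le> card J2 * 2 ^ e"
      using D(2) mult_le_mono2[OF Pow_le, of "card J2"] unfolding J2_def by (rule order_trans)
    moreover have "V ^ m * (2 * 2 ^ e) \<le> V ^ Suc m"
      using mult_left_mono[OF V4, of "V ^ m"] by (simp add: mult.commute)
    moreover have "V ^ Suc m \<le> card J1 + 1"
      using Suc.prems(1,2) j0(1) by (simp add: J1_def)
    moreover have "1 \<le> (2::nat) ^ e" "1 * 2 ^ e \<le> V ^ m * 2 ^ e"
      using Vm by (simp, intro mult_right_mono) auto
    ultimately show False by (simp add: algebra_simps)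
  qed
  then obtain J' H \<kappa> where J': "J' \<subseteq> J2" "card J' = m" "\<forall>j \<in> J'. H j \<subseteq> R' j \<and> H j \<in> homogeneous_trees r f a n"
      "\<forall>i \<in> J'. \<forall>j \<in> J'. i < j \<longrightarrow> (\<forall>x \<in> H i. \<forall>y \<in> H j. f x y = \<kappa> i)"
    using Suc.IH[of J2 R'] J2 R' by blast
  \<comment> \<open>The colour of a point of \<open>Q\<close> towards all remaining trees is its
    membership in \<open>D\<close>. Making it constant halves the branching from
    \<open>2 * t\<close> to \<open>t\<close>, which still suffices for
    \<open>ramsey\<close>.\<close>
  have "\<exists>c \<in> UNIV. \<exists>Q' \<subseteq> Q. Q' \<in> gtree r ?S t n \<and> (\<lambda>x. x \<in> D) ` Q' \<subseteq> {c}"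
    by (rule gtree_pigeonhole_elements[OF r _ _ _ Q(4)]) auto
  then obtain c Q' where Q': "Q' \<subseteq> Q" "Q' \<in> gtree r ?S t n" "\<forall>x \<in> Q'. (x \<in> D) = c"
    by (simp only: image_subset_iff singleton_iff) blast
  obtain G where G: "G \<subseteq> Q'" "G \<in> homogeneous_trees r f a n" using ramsey[OF Q'(2)] by blast
  have J'J: "J' \<subseteq> J - {j0}" using J'(1) J2 by auto
  have "finite J'" using J'J Suc.prems(1) finite_subset by blast
  have G_col: "f x y = c" if "x \<in> G" "j \<in> J'" "y \<in> H j" for x y j
  proof -
    have "col y = D" using that J'(1,3) R' by (fastforce simp: J2_def J1_def)
    moreover have "x \<in> Q" "(x \<in> D) = c" using that G(1) Q' by auto
    ultimately show ?thesis by (auto simp: col_def)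
  qed
  have H: "H j \<subseteq> R j" if "j \<in> J'" for j using that J'(3) J'J R' by blast
  show ?case
  proof (intro exI conjI)
    show "insert j0 J' \<subseteq> J" using J'J j0 by blast
    show "card (insert j0 J') = Suc m" using J'(2) J'J \<open>finite J'\<close> by (simp add: card_insert_if) blast
    show "\<forall>j \<in> insert j0 J'. (H(j0 := G)) j \<subseteq> R j \<and> (H(j0 := G)) j \<in> homogeneous_trees r f a n"
      using G Q' Q(1) H J'(3) by auto
    show "\<forall>i \<in> insert j0 J'. \<forall>j \<in> insert j0 J'. i < j \<longrightarrow>
        (\<forall>x \<in> (H(j0 := G)) i. \<forall>y \<in> (H(j0 := G)) j. f x y = (\<kappa>(j0 := c)) i)"
    proof (intro ballI impI)
      fix i j x y
      assume ij: "i \<in> insert j0 J'" "j \<in> insert j0 J'" "i < j"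
        and xy: "x \<in> (H(j0 := G)) i" "y \<in> (H(j0 := G)) j"
      have j: "j \<in> J'" "j \<noteq> j0" using ij J'J j0(2) by (auto dest: less_asym)
      show "f x y = (\<kappa>(j0 := c)) i"
      proof (cases "i = j0")
        case True
        then show ?thesis using G_col[of x j y] xy j by simp
      next
        case False
        then show ?thesis using J'(4) ij xy j by auto
      qed
    qed
  qed
qed

text \<open>Among the children, \<open>2 * p\<close> are thinned so that the colour from each to all
  later ones depends on the earlier child alone; one of the two colours belongs to at least
  \<open>p\<close> of them. The lower levels come from the induction hypothesis, passed to
  \<open>end_homogeneous_trees\<close>.\<close>

lemma tree_ramsey:
  assumes r: "hereditary r" and p: "0 < p" and "n \<le> p"
    and "R \<in> gtree r (range (\<lambda>x. {x})) (tree_bound p n) n"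
  shows "\<exists>H \<subseteq> R. H \<in> homogeneous_trees r f p n"
  using assms(3,4)
proof (induction n arbitrary: R)
  case 0
  then show ?case by auto
next
  case (Suc n)
  define t where "t = tree_bound p n"
  have t: "0 < t" using le_tree_bound[OF p, of n] p by (simp add: t_def)
  define V where "V = 2 * t * (2 * t) * 2 ^ ((2 * t) ^ p)"
  have b: "tree_bound p (Suc n) = V ^ (2 * p)" by (simp add: V_def t_def)
  obtain X where X: "finite R" "\<And>i. i < V ^ (2 * p) \<Longrightarrow>
      X i \<subseteq> R \<and> X i \<in> gtree r (range (\<lambda>x. {x})) (V ^ (2 * p)) n"
      "\<And>i j. i < j \<Longrightarrow> j < V ^ (2 * p) \<Longrightarrow> r (X i) (X j)"
    using Suc.prems(2) unfolding b gtree.simps by (rule gmultE) (rule that)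
  have "(2 * t) ^ n \<le> (2 * t) ^ p" using t Suc.prems(1) by (intro power_increasing) auto
  moreover have "\<exists>H \<subseteq> R. H \<in> homogeneous_trees r f p n" if "R \<in> gtree r (range (\<lambda>x. {x})) t n" for R
    using Suc.IH[of R] Suc.prems(1) that by (simp add: t_def)
  ultimately obtain J H \<kappa> where J: "J \<subseteq> {..<V ^ (2 * p)}" "card J = 2 * p"
      "\<forall>j \<in> J. H j \<subseteq> X j \<and> H j \<in> homogeneous_trees r f p n"
      "\<forall>i \<in> J. \<forall>j \<in> J. i < j \<longrightarrow> (\<forall>x \<in> H i. \<forall>y \<in> H j. f x y = \<kappa> i)"
    using end_homogeneous_trees[OF r _ t _ V_def, of n f p "{..<V ^ (2 * p)}" "2 * p" X] X(2) by auto
  have "finite J" using J(1) finite_subset by blast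
  then obtain c where c: "card J \<le> card (\<kappa> -` {c} \<inter> J) * card (UNIV :: bool set)"
    using pigeonhole_card[of \<kappa> J UNIV] by auto
  define I where "I = \<kappa> -` {c} \<inter> J"
  have I: "I \<subseteq> J" "p \<le> card I" "finite I" using c J(2) \<open>finite J\<close> by (auto simp: I_def)
  have sep: "r (H i) (H j)" if "i \<in> I" "j \<in> I" "i < j" for i j
  proof -
    have "i \<in> J" "j \<in> J" "j < V ^ (2 * p)" using that I(1) J(1) by auto
    then have "r (X i) (X j)" "H i \<subseteq> X i" "H j \<subseteq> X j" using that(3) X(3) J(3) by auto
    then show ?thesis using r unfolding hereditary_def by blast
  qed
  have "(\<Union>j \<in> I. H j) \<in> homogeneous_trees r f p (Suc n)"
    unfolding homogeneous_trees.simps mem_Collect_eq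
  proof (intro exI conjI ballI impI)
    show "f x y = c" if "i \<in> I" "j \<in> I" "i < j" "x \<in> H i" "y \<in> H j" for i j x y
    proof -
      have "\<kappa> i = c" using that(1) by (simp add: I_def)
      then show ?thesis using that J(4) I(1) by blast
    qed
  qed (use I J(3) sep in auto)
  moreover have "(\<Union>j \<in> I. H j) \<subseteq> R"
  proof -
    have "H j \<subseteq> R" if "j \<in> I" for j
    proof -
      have "j \<in> J" "j < V ^ (2 * p)" using that I(1) J(1) by auto
      then show ?thesis using X(2) J(3) by (meson order_trans)
    qed
    then show ?thesis by blast
  qed
  ultimately show ?case by blast
qed

section \<open>Large sets as trees\<close>

text \<open>The elementwise form of apartness passes to arbitrary subsets, including empty ones.\<close>

definition sep :: "(nat \<Rightarrow> nat \<Rightarrow> nat \<Rightarrow> bool) \<Rightarrow> nat set \<Rightarrow> nat set \<Rightarrow> bool" where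
  "sep \<theta> A B \<longleftrightarrow> set_less A B \<and>
     (\<forall>a \<in> A. \<forall>b \<in> B. \<forall>c \<in> B. \<forall>x < a. \<exists>y < b. \<forall>z < c. \<theta> x y z)"

lemma sep_iff:
  assumes "finite A" "A \<noteq> {}" "finite B" "B \<noteq> {}"
  shows "sep \<theta> A B \<longleftrightarrow> set_less A B \<and> apart \<theta> A B"
proof
  assume "sep \<theta> A B"
  then show "set_less A B \<and> apart \<theta> A B"
    using Max_in[OF assms(1,2)] Max_in[OF assms(3,4)] Min_in[OF assms(3,4)]
    unfolding sep_def apart_def by blast
next
  assume *: "set_less A B \<and> apart \<theta> A B"
  have "\<exists>y < b. \<forall>z < c. \<theta> x y z" if "a \<in> A" "b \<in> B" "c \<in> B" "x < a" for a b c x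
  proof -
    have "x < Max A" using that assms by (meson Max_ge less_le_trans)
    then obtain y where "y < Min B" "\<forall>z < Max B. \<theta> x y z" using * unfolding apart_def by blast
    moreover have "Min B \<le> b" "c \<le> Max B" using that assms by auto
    ultimately show ?thesis by (meson less_le_trans)
  qed
  then show "sep \<theta> A B" using * unfolding sep_def by blast
qed

lemma hereditary_sep: "hereditary (sep \<theta>)"
  unfolding hereditary_def sep_def set_less_def by (meson subsetD)

lemma sep_set_less: "sep \<theta> A B \<Longrightarrow> set_less A B"
  by (simp add: sep_def)

lemma fam_mult_eq_gmult:
  assumes "\<And>Z. Z \<in> L \<Longrightarrow> finite Z \<and> Z \<noteq> {}"
  shows "fam_mult \<theta> L k = gmult (sep \<theta>) L k"
proof -
  have *: "(\<forall>j < k. \<forall>i < j. set_less (X i) (X j) \<and> apart \<theta> (X i) (X j)) \<longleftrightarrow>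
      (\<forall>j < k. \<forall>i < j. sep \<theta> (X i) (X j))" if "\<forall>i < k. X i \<subseteq> F \<and> X i \<in> L" for X :: "nat \<Rightarrow> nat set" and F
  proof -
    have "sep \<theta> (X i) (X j) \<longleftrightarrow> set_less (X i) (X j) \<and> apart \<theta> (X i) (X j)" if "j < k" "i < j" for i j
      using sep_iff[of "X i" "X j"] assms that \<open>\<forall>i < k. X i \<subseteq> F \<and> X i \<in> L\<close> by (meson less_trans)
    then show ?thesis by blast
  qed
  then show ?thesis unfolding fam_mult_def gmult_def by (intro Collect_cong conj_cong refl ex_cong1 *)
qed

lemma gtree_nonempty:
  assumes "\<And>Z. Z \<in> L \<Longrightarrow> Z \<noteq> {}" "F \<in> gtree r L b n" "0 < b"
  shows "F \<noteq> {}"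
  using gtree_leaf[OF assms(2,3)] assms(1) by blast

lemma fam_mults_eq_gtree:
  assumes "\<And>Z. Z \<in> L \<Longrightarrow> finite Z \<and> Z \<noteq> {}" "0 < b"
  shows "fam_mults \<theta> L (replicate n b) = gtree (sep \<theta>) L b n"
  using assms(1)
proof (induction n arbitrary: L)
  case (Suc n)
  let ?M = "gmult (sep \<theta>) L b"
  have M: "finite Z \<and> Z \<noteq> {}" if "Z \<in> ?M" for Z
  proof -
    have Z: "Z \<in> gtree (sep \<theta>) L b 1" using that by simp
    show ?thesis using finite_gtree[OF Z] gtree_nonempty[OF _ Z assms(2)] Suc.prems by blast
  qed
  have "fam_mults \<theta> L (replicate (Suc n) b) = fam_mults \<theta> ?M (replicate n b)"
    using Suc.prems by (simp add: fam_mult_eq_gmult)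
  also have "\<dots> = gtree (sep \<theta>) ?M b n" using M by (rule Suc.IH)
  finally show ?case by (simp only: gtree_gmult)
qed simp

lemma large_finite_nonempty: "X \<in> large \<theta> n \<Longrightarrow> finite X \<and> X \<noteq> {}"
  by (cases n) auto

text \<open>Excluding 0 makes the branching positive. The members of all intermediate products are
  then nonempty, as the translation of \<open>apart\<close> into \<open>sep\<close>
  requires.\<close>

lemma large_Suc_iff:
  assumes "0 \<notin> X"
  shows "X \<in> large \<theta> (Suc n) \<longleftrightarrow>
    finite X \<and> X \<noteq> {} \<and> X - {Min X} \<in> gtree (sep \<theta>) (large \<theta> n) (Min X) (Suc n)"
proof (cases "finite X \<and> X \<noteq> {}")
  case True
  then have "0 < Min X" using assms Min_in gr0I by metis
  then have "fam_mults \<theta> (large \<theta> n) (replicate (Suc n) (Min X)) =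
      gtree (sep \<theta>) (large \<theta> n) (Min X) (Suc n)"
    by (intro fam_mults_eq_gtree large_finite_nonempty)
  then show ?thesis by (simp only: large.simps mem_Collect_eq)
qed auto

lemma large_SucD:
  assumes "X \<in> large \<theta> (Suc n)" "0 \<notin> X"
  shows "X - {Min X} \<in> gtree (sep \<theta>) (large \<theta> n) (Min X) (Suc n)" "0 < Min X"
proof -
  show "X - {Min X} \<in> gtree (sep \<theta>) (large \<theta> n) (Min X) (Suc n)"
    using assms(1) unfolding large_Suc_iff[OF assms(2)] by blast
  show "0 < Min X"
    using large_finite_nonempty[OF assms(1)] assms(2) Min_in gr0I by metis
qed

text \<open>A minimum 0 makes all multiplicities 0, and the empty remainder lies in such a product.
  This settles the theorem for sets containing 0.\<close>

lemma zero_large: "{0} \<in> large \<theta> n"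
proof (cases n)
  case (Suc m)
  have *: "{} \<in> fam_mults \<theta> L (replicate k 0)" if "{} \<in> L" for L k
    using that by (induction k arbitrary: L) (simp_all add: fam_mult_def)
  have "{} \<in> fam_mult \<theta> (large \<theta> m) 0" by (simp add: fam_mult_def)
  from *[OF this, of m] show ?thesis using Suc by simp
qed simp

declare large.simps(2) [simp del]

lemma large_insert:
  assumes "0 < x" "0 \<notin> F" "\<forall>y \<in> F. x < y" "x \<le> b" "F \<in> gtree (sep \<theta>) (large \<theta> n) b (Suc n)"
  shows "insert x F \<in> large \<theta> (Suc n)"
proof -
  have fin: "finite F" using finite_gtree[OF assms(5)] large_finite_nonempty by blast
  have "Min (insert x F) = x" using fin assms(3) by (intro Min_eqI) (auto intro: less_imp_le)
  moreover have "insert x F - {x} = F" using assms(3) by auto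
  moreover have "F \<in> gtree (sep \<theta>) (large \<theta> n) x (Suc n)" using gtree_mono[OF assms(4)] assms(5) by blast
  moreover have "0 \<notin> insert x F" using assms(1,2) by simp
  ultimately show ?thesis using fin large_Suc_iff[of "insert x F"] by simp
qed

lemma large_pred:
  assumes "X \<in> large \<theta> (Suc n)" "0 \<notin> X"
  shows "\<exists>Y \<subseteq> X - {Min X}. Y \<in> large \<theta> n"
  using gtree_leaf[OF large_SucD[OF assms]] .

lemma large_antimono:
  assumes "m \<le> n" "X \<in> large \<theta> n" "0 \<notin> X"
  shows "\<exists>Y \<subseteq> X. Y \<in> large \<theta> m"
  using assms
proof (induction n arbitrary: X rule: dec_induct)
  case (step n)
  obtain Y where "Y \<subseteq> X - {Min X}" "Y \<in> large \<theta> n" using large_pred[OF step.prems] by blast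
  moreover then have "0 \<notin> Y" using step.prems by blast
  ultimately show ?case using step.IH[of Y] by blast
qed auto

text \<open>Each exponent given up raises the minimum strictly. The step uses this to bound
  \<open>k\<close> by the maximum of the first copy.\<close>

lemma large_Max:
  assumes "X \<in> large \<theta> n" "0 \<notin> X"
  shows "n + Min X \<le> Max X"
  using assms
proof (induction n arbitrary: X)
  case 0
  then have "finite X" "Max X \<in> X" by auto
  then show ?case using Min_le by fastforce
next
  case (Suc n)
  obtain Y where Y: "Y \<subseteq> X - {Min X}" "Y \<in> large \<theta> n" using large_pred[OF Suc.prems] by blast
  have X: "finite X" using large_finite_nonempty[OF Suc.prems(1)] by blast
  have ne: "Y \<noteq> {}" "finite Y" using large_finite_nonempty[OF Y(2)] by auto
  have "0 \<notin> Y" using Y(1) Suc.prems(2) by blast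
  then have "n + Min Y \<le> Max Y" using Suc.IH Y(2) by blast
  moreover have "Max Y \<le> Max X" using Y(1) ne X by (intro Max_mono) auto
  moreover have "Min X < Min Y"
    using Min_in[OF ne(2,1)] Y(1) X by (metis Diff_iff Min_le insertCI le_neq_implies_less subsetD)
  ultimately show ?case by simp
qed

section \<open>Pigeonhole principles for large sets\<close>

lemma large_copies:
  assumes "X \<in> large \<theta> (Suc n)" "0 \<notin> X"
  obtains E :: "nat \<Rightarrow> nat set" where
    "\<And>i. i < Min X \<Longrightarrow> E i \<subseteq> X - {Min X} \<and> E i \<in> large \<theta> n"
    "\<And>i j. i < j \<Longrightarrow> j < Min X \<Longrightarrow> sep \<theta> (E i) (E j)"
proof -
  from gtree_gmult_subset[OF large_SucD[OF assms]]
  obtain Z where Z: "Z \<subseteq> X - {Min X}" "Z \<in> gmult (sep \<theta>) (large \<theta> n) (Min X)" by blast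
  from Z(2) show ?thesis
  proof (rule gmultE)
    fix E :: "nat \<Rightarrow> nat set"
    assume "\<And>i. i < Min X \<Longrightarrow> E i \<subseteq> Z \<and> E i \<in> large \<theta> n"
      and "\<And>i j. i < j \<Longrightarrow> j < Min X \<Longrightarrow> sep \<theta> (E i) (E j)"
    then show ?thesis using Z(1) by (intro that[of E]) (blast, blast)
  qed
qed

text \<open>The last copy yields a tree of some colour \<open>i\<close> whose branching exceeds all elements of the
  other copies. Either one of these elements has colour \<open>i\<close> and can serve as the root of that tree, or
  the other copies avoid the colour \<open>i\<close> altogether. The step from \<open>Suc m\<close> to \<open>m\<close> pays for the
  innermost level of the tree, which is used up to make its leaves homogeneous.\<close>

lemma large_pigeonhole_copies:
  assumes X: "finite X" "0 \<notin> X" "\<forall>x \<in> X. \<forall>y \<in> X. x < y \<longrightarrow> x * x < y"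
    and "finite C" "C \<noteq> {}"
    and "\<And>j. j < card C \<Longrightarrow> E j \<subseteq> X \<and> E j \<in> large \<theta> (Suc m) \<and> (\<forall>x \<in> E j. card C \<le> x) \<and> col ` E j \<subseteq> C"
    and "\<And>i j. i < j \<Longrightarrow> j < card C \<Longrightarrow> set_less (E i) (E j)"
  shows "\<exists>i \<in> C. \<exists>H \<subseteq> (\<Union>j < card C. E j). H \<in> large \<theta> m \<and> col ` H \<subseteq> {i}"
  using assms(4-7)
proof (induction m arbitrary: C E)
  case 0
  have "0 < card C" using 0(1,2) by (simp add: card_gt_0_iff)
  then have E0: "E 0 \<in> large \<theta> (Suc 0)" "col ` E 0 \<subseteq> C" using 0(3) by blast+
  then obtain x where x: "x \<in> E 0" using large_finite_nonempty by blast
  show ?case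
  proof (intro bexI[of _ "col x"] exI[of _ "{x}"] conjI)
    show "{x} \<subseteq> (\<Union>j < card C. E j)" using x \<open>0 < card C\<close> by blast
  qed (use x E0(2) in auto)
next
  case (Suc m)
  \<comment> \<open>An inner induction removes colours one at a time at fixed exponent; the outer
    hypothesis, for arbitrary colour sets and copies, treats the lowest level of the trees.\<close>
  note IH = Suc.IH
  from Suc.prems show ?case
  proof (induction "card C" arbitrary: C)
    case 0
    then show ?case by simp
  next
    case (Suc c)
    note C = Suc.prems(1,2) and E = Suc.prems(3) and less = Suc.prems(4)
    have c: "c < card C" "card C = Suc c" using Suc.hyps(2) by simp_all
    have Ec: "E c \<subseteq> X" "E c \<in> large \<theta> (Suc (Suc m))" "\<forall>x \<in> E c. card C \<le> x" "col ` E c \<subseteq> C" "0 \<notin> E c"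
      using E[OF c(1)] X(2) by blast+
    show ?case
    proof (cases "c = 0")
      case True
      then obtain i where i: "C = {i}" using c(2) by (auto simp: card_1_singleton_iff)
      obtain Y where "Y \<subseteq> E c - {Min (E c)}" "Y \<in> large \<theta> (Suc m)" using large_pred[OF Ec(2,5)] by blast
      then show ?thesis using i Ec(4) True by (intro bexI[of _ i] exI[of _ Y]) auto
    next
      case False
      define U where "U = (\<Union>j < c. E j)"
      have UX: "U \<subseteq> X" using E c unfolding U_def by (meson UN_least lessThan_iff less_trans)
      have fU: "finite U" using UX X(1) finite_subset by blast
      have "E 0 \<subseteq> U" using False by (auto simp: U_def)
      moreover have "E 0 \<noteq> {}" using E[of 0] c(2) large_finite_nonempty[of "E 0"] by auto
      ultimately have U0: "U \<noteq> {}" by blast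
      define e where "e = Min (E c)"
      have e: "e \<in> E c" using large_finite_nonempty[OF Ec(2)] by (auto simp: e_def)
      then have "e \<in> X" using Ec(1) by blast
      have U_less: "x < y" if "x \<in> U" "y \<in> E c" for x y
        using that less[of _ c] c unfolding U_def set_less_def by blast
      \<comment> \<open>A tree of branching \<open>h\<close> can be rooted at any element of
        \<open>U\<close>. Since \<open>card C \<le> h\<close> and \<open>h * h < e\<close>,
        branching \<open>e\<close> can be divided by the number of colours and still leave
        \<open>h\<close>.\<close>
      define h where "h = Max U"
      have h: "h \<in> U" using fU U0 by (simp add: h_def)
      have "card C \<le> h" using h E c unfolding U_def by (meson UN_E lessThan_iff less_trans)
      moreover have "h * h < e" using X(3) h UX \<open>e \<in> X\<close> e U_less by blast
      ultimately have he: "h * card C \<le> e" by (meson less_imp_le mult_le_mono2 order_trans)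
      have ce: "card C \<le> e" using Ec(3) e by blast
      \<comment> \<open>The lowest level is absorbed into the leaves: each new leaf holds
        \<open>e\<close> copies, enough to apply the outer hypothesis to it.\<close>
      have tree: "E c - {e} \<in> gtree (sep \<theta>) (gmult (sep \<theta>) (large \<theta> (Suc m)) e) e (Suc m)"
        using large_SucD(1)[OF Ec(2,5)] unfolding gtree_gmult e_def .
      have "\<exists>i \<in> C. \<exists>F \<subseteq> E c - {e}. F \<in> gtree (sep \<theta>) (large \<theta> m) h (Suc m) \<and> col ` F \<subseteq> {i}"
      proof (rule gtree_pigeonhole[OF hereditary_sep C _ tree he])
        fix Z assume Z: "Z \<in> gmult (sep \<theta>) (large \<theta> (Suc m)) e" "Z \<subseteq> E c - {e}"
        from Z(1) show "\<exists>i \<in> C. \<exists>Z' \<subseteq> Z. Z' \<in> large \<theta> m \<and> col ` Z' \<subseteq> {i}"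
        proof (rule gmultE)
          fix Y :: "nat \<Rightarrow> nat set"
          assume Y: "\<And>i. i < e \<Longrightarrow> Y i \<subseteq> Z \<and> Y i \<in> large \<theta> (Suc m)"
            "\<And>i j. i < j \<Longrightarrow> j < e \<Longrightarrow> sep \<theta> (Y i) (Y j)"
          have YZ: "Y j \<subseteq> Z" if "j < card C" for j using Y(1)[of j] that ce by simp
          have "\<exists>i \<in> C. \<exists>H \<subseteq> (\<Union>j < card C. Y j). H \<in> large \<theta> m \<and> col ` H \<subseteq> {i}"
          proof (rule IH[OF C])
            fix j assume j: "j < card C"
            then have "Y j \<in> large \<theta> (Suc m)" "Y j \<subseteq> E c" using Y(1)[of j] Z(2) ce by auto
            then show "Y j \<subseteq> X \<and> Y j \<in> large \<theta> (Suc m) \<and> (\<forall>x \<in> Y j. card C \<le> x) \<and> col ` Y j \<subseteq> C"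
              using Ec(1,3,4) by blast
          next
            fix i j assume "i < j" "j < card C"
            then show "set_less (Y i) (Y j)" using Y(2)[of i j] ce sep_set_less by auto
          qed
          moreover have "(\<Union>j < card C. Y j) \<subseteq> Z" using YZ by blast
          ultimately show ?thesis by (meson order_trans)
        qed
      qed
      then obtain i F where F: "i \<in> C" "F \<subseteq> E c - {e}" "F \<in> gtree (sep \<theta>) (large \<theta> m) h (Suc m)"
        "col ` F \<subseteq> {i}" by blast
      have sub: "U \<subseteq> (\<Union>j < card C. E j)" "E c \<subseteq> (\<Union>j < card C. E j)"
        using c by (auto simp: U_def less_Suc_eq)
      show ?thesis
      proof (cases "\<exists>x \<in> U. col x = i")
        case True
        then obtain x where x: "x \<in> U" "col x = i" by blast
        have "insert x F \<in> large \<theta> (Suc m)"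
        proof (rule large_insert[OF _ _ _ _ F(3)])
          show "0 < x" using x UX X(2) by (metis gr0I subsetD)
          show "0 \<notin> F" using F(2) Ec(5) by blast
          show "\<forall>y \<in> F. x < y" using F(2) U_less x(1) by blast
          show "x \<le> h" using x(1) fU by (simp add: h_def)
        qed
        moreover have "insert x F \<subseteq> (\<Union>j < card C. E j)" using sub x(1) F(2) by blast
        moreover have "col ` insert x F \<subseteq> {i}" using F(4) x(2) by simp
        ultimately show ?thesis using F(1) by blast
      next
        case False
        \<comment> \<open>No element of \<open>U\<close> has colour \<open>i\<close>, so the first
          \<open>c\<close> copies use only the \<open>c\<close> remaining colours.\<close>
        have card: "card (C - {i}) = c" using c(2) F(1) C(1) by simp
        have "\<exists>k \<in> C - {i}. \<exists>H \<subseteq> (\<Union>j < card (C - {i}). E j). H \<in> large \<theta> (Suc m) \<and> col ` H \<subseteq> {k}"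
        proof (rule Suc.hyps(1))
          show "C - {i} \<noteq> {}" using card \<open>c \<noteq> 0\<close> by force
          fix j assume j: "j < card (C - {i})"
          then have "E j \<subseteq> U" using card by (auto simp: U_def)
          then show "E j \<subseteq> X \<and> E j \<in> large \<theta> (Suc (Suc m)) \<and> (\<forall>x \<in> E j. card (C - {i}) \<le> x) \<and>
              col ` E j \<subseteq> C - {i}"
            using E[of j] j card c False by force
        qed (use C card c less in auto)
        then show ?thesis using sub(1) card unfolding U_def by (meson DiffD1 order_trans)
      qed
    qed
  qed
qed

text \<open>One exponent is spent on extracting \<open>card C\<close> copies from \<open>Z\<close>,
  the other in \<open>large_pigeonhole_copies\<close>.\<close>

lemma large_pigeonhole:
  assumes X: "finite X" "0 \<notin> X" "\<forall>x \<in> X. \<forall>y \<in> X. x < y \<longrightarrow> x * x < y"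
    and Z: "Z \<subseteq> X" "Z \<in> large \<theta> (Suc (Suc m))"
    and C: "finite C" "C \<noteq> {}" "card C \<le> Min Z" "col ` Z \<subseteq> C"
  shows "\<exists>Z' \<subseteq> Z. Z' \<in> large \<theta> m \<and> (\<forall>x \<in> Z'. \<forall>y \<in> Z'. col x = col y)"
proof -
  have "0 \<notin> Z" using Z(1) X(2) by blast
  from Z(2) this show ?thesis
  proof (rule large_copies)
    fix E :: "nat \<Rightarrow> nat set"
    assume E: "\<And>i. i < Min Z \<Longrightarrow> E i \<subseteq> Z - {Min Z} \<and> E i \<in> large \<theta> (Suc m)"
      "\<And>i j. i < j \<Longrightarrow> j < Min Z \<Longrightarrow> sep \<theta> (E i) (E j)"
    have EZ: "E j \<subseteq> Z" if "j < card C" for j using E(1)[of j] that C(3) by auto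
    have "\<exists>i \<in> C. \<exists>H \<subseteq> (\<Union>j < card C. E j). H \<in> large \<theta> m \<and> col ` H \<subseteq> {i}"
    proof (rule large_pigeonhole_copies[OF X C(1,2)])
      fix j assume j: "j < card C"
      have "card C \<le> x" if "x \<in> Z" for x
        using that C(3) Min_le[of Z x] large_finite_nonempty[OF Z(2)] by linarith
      then show "E j \<subseteq> X \<and> E j \<in> large \<theta> (Suc m) \<and> (\<forall>x \<in> E j. card C \<le> x) \<and> col ` E j \<subseteq> C"
        using EZ[OF j] E(1)[of j] j C(3,4) Z(1) by auto
    next
      fix i j assume "i < j" "j < card C"
      then show "set_less (E i) (E j)" using E(2)[of i j] C(3) sep_set_less by auto
    qed
    then obtain i H where H: "H \<subseteq> (\<Union>j < card C. E j)" "H \<in> large \<theta> m" "col ` H \<subseteq> {i}" by blast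
    have "H \<subseteq> Z" using H(1) EZ by blast
    moreover have "\<forall>x \<in> H. \<forall>y \<in> H. col x = col y"
      using H(3) by (simp add: image_subset_iff)
    ultimately show ?thesis using H(2) by blast
  qed
qed

section \<open>Transitive sets\<close>

text \<open>The two colours are truth values, so one equality treats both of them.\<close>

definition transitive_on :: "(nat \<Rightarrow> nat \<Rightarrow> bool) \<Rightarrow> nat set \<Rightarrow> bool" where
  "transitive_on P H \<longleftrightarrow> (\<forall>x \<in> H. \<forall>y \<in> H. \<forall>z \<in> H. x < y \<and> y < z \<and> P x y = P y z \<longrightarrow> P x z = P x y)"

lemma transitive_on_insert:
  assumes H: "transitive_on P H" and less: "\<And>y. y \<in> H \<Longrightarrow> x < y" and c: "\<And>y. y \<in> H \<Longrightarrow> P x y = c"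
  shows "transitive_on P (insert x H)"
  unfolding transitive_on_def
proof (intro ballI impI)
  fix u v w assume uvw: "u \<in> insert x H" "v \<in> insert x H" "w \<in> insert x H"
    and lt: "u < v \<and> v < w \<and> P u v = P v w"
  have "x \<le> u" using uvw(1) less less_imp_le by blast
  then have vw: "v \<in> H" "w \<in> H" using uvw(2,3) lt by auto
  show "P u w = P u v"
  proof (cases "u = x")
    case True
    then show ?thesis using c vw by simp
  next
    case False
    then have "u \<in> H" using uvw(1) by simp
    then show ?thesis using H vw lt unfolding transitive_on_def by blast
  qed
qed

text \<open>If x < y < z do not all lie in one piece, then x and z lie in different pieces, and so
  do x and y or y and z. The common colour of the two shorter pairs is therefore \<open>c\<close>,
  which is also the colour of x and z.\<close>

lemma transitive_on_UN:
  fixes J :: "nat set"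
  assumes U: "\<And>i. i \<in> J \<Longrightarrow> transitive_on P (U i)"
    and less: "\<And>i j. i \<in> J \<Longrightarrow> j \<in> J \<Longrightarrow> i < j \<Longrightarrow> set_less (U i) (U j)"
    and c: "\<And>i j x y. i \<in> J \<Longrightarrow> j \<in> J \<Longrightarrow> i < j \<Longrightarrow> x \<in> U i \<Longrightarrow> y \<in> U j \<Longrightarrow> P x y = c"
  shows "transitive_on P (\<Union>i \<in> J. U i)"
  unfolding transitive_on_def
proof (intro ballI impI)
  fix x y z
  assume "x \<in> (\<Union>i \<in> J. U i)" "y \<in> (\<Union>i \<in> J. U i)" "z \<in> (\<Union>i \<in> J. U i)"
    and lt: "x < y \<and> y < z \<and> P x y = P y z"
  then obtain i j k where ijk: "i \<in> J" "x \<in> U i" "j \<in> J" "y \<in> U j" "k \<in> J" "z \<in> U k" by blast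
  have mono: "a \<le> b" if "a \<in> J" "b \<in> J" "u \<in> U a" "v \<in> U b" "u < v" for a b u v
    using less[of b a] that unfolding set_less_def by (meson less_asym not_le)
  have "i \<le> j" "j \<le> k" using mono ijk lt by blast+
  then consider "i = j" "j = k" | "i < k" "i < j" | "i < k" "j < k" by linarith
  then show "P x z = P x y"
  proof cases
    case 1
    then show ?thesis using U[of i] ijk lt unfolding transitive_on_def by blast
  next
    case 2
    then show ?thesis using c[of i k x z] c[of i j x y] ijk by simp
  next
    case 3
    then show ?thesis using c[of i k x z] c[of j k y z] ijk lt by simp
  qed
qed

text \<open>Each leaf \<open>Z\<close> is replaced by \<open>H Z\<close>. Colours between elements
  of successive leaves depend on the leaves alone, so homogeneity at the nodes carries over and
  \<open>transitive_on_UN\<close> applies level by level.\<close>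

lemma homogeneous_trees_Union:
  assumes "R \<in> homogeneous_trees (Union_rel (sep \<theta>)) f a n"
    and "\<And>Z. Z \<in> R \<Longrightarrow> H Z \<subseteq> Z \<and> H Z \<in> L \<and> transitive_on P (H Z)"
    and "\<And>Z W x y. Z \<in> R \<Longrightarrow> W \<in> R \<Longrightarrow> set_less Z W \<Longrightarrow> x \<in> H Z \<Longrightarrow> y \<in> H W \<Longrightarrow> P x y = f Z W"
    and L: "\<And>Z. Z \<in> L \<Longrightarrow> finite Z"
  shows "\<Union>(H ` R) \<in> gtree (sep \<theta>) L a n \<and> transitive_on P (\<Union>(H ` R))"
  using assms(1-3)
proof (induction n arbitrary: R)
  case 0
  then obtain Z where "R = {Z}" by auto
  then show ?case using 0(2) by simp
next
  case (Suc n)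
  obtain J :: "nat set" and X c where J: "finite J" "a \<le> card J" and R: "R = (\<Union>j \<in> J. X j)"
    and X: "\<forall>j \<in> J. X j \<in> homogeneous_trees (Union_rel (sep \<theta>)) f a n"
    and XX: "\<forall>i \<in> J. \<forall>j \<in> J. i < j \<longrightarrow> Union_rel (sep \<theta>) (X i) (X j) \<and>
      (\<forall>x \<in> X i. \<forall>y \<in> X j. f x y = c)"
    using Suc.prems(1) unfolding homogeneous_trees.simps mem_Collect_eq by (elim exE conjE) (rule that)
  define U where "U j = \<Union>(H ` X j)" for j
  have U: "U j \<in> gtree (sep \<theta>) L a n \<and> transitive_on P (U j)" if j: "j \<in> J" for j
  proof -
    have "X j \<subseteq> R" using R j by blast
    show ?thesis unfolding U_def
    proof (rule Suc.IH)
      show "X j \<in> homogeneous_trees (Union_rel (sep \<theta>)) f a n" using X j by blast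
    qed (use Suc.prems(2,3) \<open>X j \<subseteq> R\<close> in blast)+
  qed
  have HU: "\<Union>(H ` R) = (\<Union>j \<in> J. U j)" by (auto simp: R U_def)
  have U_sub: "U j \<subseteq> \<Union>(X j)" if "j \<in> J" for j
    using that Suc.prems(2) unfolding U_def R by blast
  have sep: "sep \<theta> (U i) (U j)" if "i \<in> J" "j \<in> J" "i < j" for i j
  proof -
    have "sep \<theta> (\<Union>(X i)) (\<Union>(X j))" using XX that unfolding Union_rel_def by blast
    then show ?thesis using hereditary_sep U_sub that unfolding hereditary_def by blast
  qed
  have "(\<Union>j \<in> J. U j) \<in> gmult (sep \<theta>) (gtree (sep \<theta>) L a n) a"
  proof (rule gmultI[OF _ J, where X = U])
    show "finite (\<Union>j \<in> J. U j)"
    proof (rule finite_UN_I[OF J(1)])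
      fix j assume "j \<in> J"
      then show "finite (U j)" using U L finite_gtree by blast
    qed
  qed (use U sep in blast)+
  moreover have "transitive_on P (\<Union>j \<in> J. U j)"
  proof (rule transitive_on_UN)
    fix i j x y assume ij: "i \<in> J" "j \<in> J" "i < j" and "x \<in> U i" "y \<in> U j"
    then obtain Z W where ZW: "Z \<in> X i" "W \<in> X j" "x \<in> H Z" "y \<in> H W" unfolding U_def by blast
    have "sep \<theta> (\<Union>(X i)) (\<Union>(X j))" using XX ij unfolding Union_rel_def by blast
    then have "set_less Z W" using ZW(1,2) unfolding sep_def set_less_def by blast
    moreover have "Z \<in> R" "W \<in> R" using ZW ij R by blast+
    ultimately have "P x y = f Z W" using Suc.prems(3) ZW by blast
    also have "\<dots> = c" using XX ij ZW by blast
    finally show "P x y = c" .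
  qed (use U sep sep_set_less in blast)+
  ultimately show ?case unfolding HU by simp
qed

section \<open>The inductive step on sparse sets\<close>

lemma sparse_growth_square:
  assumes "sparse growth X" "0 \<notin> X" "x \<in> X" "y \<in> X" "x < y"
  shows "x * x < y"
proof -
  have "0 < x" using assms(2,3) gr0I by metis
  moreover have "growth x < y" using assms unfolding sparse_def by blast
  ultimately show ?thesis using square_le_growth[of x] by linarith
qed

text \<open>The elements below \<open>z\<close> are positive, so there are at most as many as their
  maximum \<open>w\<close>, and \<open>growth w < z\<close> exceeds the number of their subsets.
  This counts the colour patterns towards everything before a leaf.\<close>

lemma sparse_growth_below:
  assumes "sparse growth X" "0 \<notin> X" "z \<in> X"
  shows "card (Pow (X \<inter> {..<z})) \<le> z"
proof (cases "X \<inter> {..<z} = {}")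
  case True
  then show ?thesis using assms(2,3) by (cases z) auto
next
  case False
  define w where "w = Max (X \<inter> {..<z})"
  have w: "w \<in> X" "w < z" using Max_in[of "X \<inter> {..<z}"] False by (auto simp: w_def)
  have "0 < w" using w(1) assms(2) gr0I by metis
  have "x \<in> {1..w}" if "x \<in> X \<inter> {..<z}" for x
    using that assms(2) Max_ge[of "X \<inter> {..<z}" x] by (cases x) (auto simp: w_def)
  then have "card (X \<inter> {..<z}) \<le> card {1..w}" by (intro card_mono) auto
  then have "card (X \<inter> {..<z}) \<le> 2 * w" by simp
  then have "card (Pow (X \<inter> {..<z})) \<le> 2 ^ (2 * w)"
    by (subst card_Pow) (simp, rule power_increasing, auto)
  also have "\<dots> \<le> growth w" by (rule growth_lower_bound[OF \<open>0 < w\<close>])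
  also have "\<dots> < z" using assms(1,3) w unfolding sparse_def by blast
  finally show ?thesis by simp
qed

text \<open>Of the six exponents, one yields \<open>A\<close> and \<open>B\<close>, one the tree
  inside \<open>B\<close>, and each of the two pigeonholes on leaves takes two.\<close>

lemma large_transitive_step:
  assumes X: "finite X" "0 \<notin> X" "sparse growth X" "X \<in> large \<theta> (Suc (6 * k + 5))"
    and IH: "\<And>Z. Z \<subseteq> X \<Longrightarrow> Z \<in> large \<theta> (6 * k) \<Longrightarrow> \<exists>H \<subseteq> Z. transitive_on P H \<and> H \<in> large \<theta> k"
  shows "\<exists>H \<subseteq> X. transitive_on P H \<and> H \<in> large \<theta> (Suc k)"
proof -
  have "\<forall>x \<in> X. \<forall>y \<in> X. x < y \<longrightarrow> x * x < y"
    using sparse_growth_square[OF X(3,2)] by blast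
  note pigeonhole = large_pigeonhole[OF X(1,2) this]
  have "X \<noteq> {}" using large_finite_nonempty[OF X(4)] by blast
  define x0 where "x0 = Min X"
  have x0: "x0 \<in> X" "0 < x0" using X(1,2) \<open>X \<noteq> {}\<close> Min_in gr0I unfolding x0_def by metis+
  have x0_less: "x0 < y" if "y \<in> X - {x0}" for y
  proof -
    have "x0 \<le> y" using that X(1) by (simp add: x0_def)
    then show ?thesis using that by auto
  qed
  show ?thesis
  proof (cases "x0 = 1")
    case True
    \<comment> \<open>For branching 1 a single leaf is a tree of any depth, so only the colour
      towards \<open>x0\<close> has to be made constant, by a pigeonhole with two colours.\<close>
    obtain Y0 where Y0: "Y0 \<subseteq> X - {x0}" "Y0 \<in> large \<theta> (6 * k + 5)"
      using large_pred[OF X(4,2)] unfolding x0_def by blast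
    obtain Y where Y: "Y \<subseteq> Y0" "Y \<in> large \<theta> (Suc (Suc (6 * k)))"
      using large_antimono[OF _ Y0(2), of "Suc (Suc (6 * k))"] Y0(1) X(2) by auto
    have YX: "Y \<subseteq> X" using Y(1) Y0(1) by blast
    have "Min Y \<in> Y" using large_finite_nonempty[OF Y(2)] by simp
    then have "x0 < Min Y" using x0_less Y(1) Y0(1) by blast
    then have "card (UNIV :: bool set) \<le> Min Y" using True by simp
    then obtain Z where Z: "Z \<subseteq> Y" "Z \<in> large \<theta> (6 * k)" "\<forall>x \<in> Z. \<forall>y \<in> Z. P x0 x = P x0 y"
      using pigeonhole[OF YX Y(2), of UNIV "P x0"] by auto
    obtain H where H: "H \<subseteq> Z" "transitive_on P H" "H \<in> large \<theta> k"
      using IH[of Z] Z YX by blast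
    have HX: "H \<subseteq> X - {x0}" using H(1) Z(1) Y(1) Y0(1) by blast
    have "insert x0 H \<in> large \<theta> (Suc k)"
    proof (rule large_insert[where b = "Suc 0"])
      show "H \<in> gtree (sep \<theta>) (large \<theta> k) (Suc 0) (Suc k)"
        using gtree_one[OF H(3)] large_finite_nonempty[OF H(3)] by blast
    qed (use x0 HX x0_less True X(2) in auto)
    moreover have "transitive_on P (insert x0 H)"
    proof (rule transitive_on_insert[OF H(2)])
      show "P x0 y = P x0 (Min H)" if "y \<in> H" for y
        using that Z(3) H(1) Min_in[of H] large_finite_nonempty[OF H(3)] by blast
    qed (use HX x0_less in blast)
    moreover have "insert x0 H \<subseteq> X" using HX x0 by blast
    ultimately show ?thesis by blast
  next
    case False
    from X(4,2) obtain E :: "nat \<Rightarrow> nat set"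
      where E: "\<And>i. i < Min X \<Longrightarrow> E i \<subseteq> X - {Min X} \<and> E i \<in> large \<theta> (6 * k + 5)"
        "\<And>i j. i < j \<Longrightarrow> j < Min X \<Longrightarrow> sep \<theta> (E i) (E j)"
      by (rule large_copies) (rule that)
    have two: "0 < Min X" "1 < Min X" using False x0 by (simp_all add: x0_def)
    define A B where "A = E 0" and "B = E 1"
    have A: "A \<subseteq> X - {x0}" "A \<in> large \<theta> (6 * k + 5)" using E(1)[OF two(1)] by (simp_all add: A_def x0_def)
    have B: "B \<subseteq> X - {x0}" "B \<in> large \<theta> (Suc (6 * k + 4))"
      using E(1)[OF two(2)] by (simp_all add: B_def x0_def eval_nat_numeral)
    have AB: "set_less A B" using E(2)[of 0 1] two sep_set_less by (simp add: A_def B_def)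
    have BX: "B \<subseteq> X" "0 \<notin> B" using B(1) X(2) by blast+
    define p where "p = Max A"
    have pA: "p \<in> A" using large_finite_nonempty[OF A(2)] by (simp add: p_def)
    have p: "x0 < p" "p \<in> X" "0 < p" using pA A(1) x0_less by (blast, blast, force)
    have "6 * k + 5 \<le> p" using large_Max[OF A(2)] A(1) X(2) unfolding p_def by force
    then have kp: "Suc k \<le> p" by simp
    define b0 where "b0 = Min B"
    have b0: "b0 \<in> B" "\<And>y. y \<in> B \<Longrightarrow> b0 \<le> y"
      using large_finite_nonempty[OF B(2)] by (simp_all add: b0_def)
    have growth: "growth p < b0"
    proof -
      have "p < b0" using AB pA b0(1) unfolding set_less_def by blast
      then show ?thesis using X(3) p(2) b0(1) BX(1) unfolding sparse_def by blast
    qed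
    \<comment> \<open>\<open>tree_ramsey\<close> needs branching \<open>t\<close>; the tree is taken
      with \<open>2 * t\<close> because fixing the colour towards \<open>x0\<close> halves
      it.\<close>
    define t where "t = tree_bound p (Suc k)"
    have t: "0 < t" using le_tree_bound[OF p(3), of "Suc k"] p(3) unfolding t_def by linarith
    have "(2 * t) ^ Suc k \<le> (2 * tree_bound p p) ^ Suc k"
      using tree_bound_mono[OF p(3) kp] unfolding t_def by (intro power_mono mult_le_mono2 zero_le)
    also have "\<dots> \<le> (2 * tree_bound p p) ^ p"
      using le_tree_bound[OF p(3), of p] p(3) kp by (intro power_increasing) auto
    finally have "(2::nat) ^ ((2 * t) ^ Suc k) \<le> growth p"
      unfolding growth_def by (intro power_increasing) auto
    then have leaves_bound: "2 ^ ((2 * t) ^ Suc k) \<le> b0" using growth by linarith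
    have "2 * t \<le> (2 * t) ^ Suc k" using self_le_power[of "2 * t" "Suc k"] t by simp
    also have "\<dots> < 2 ^ ((2 * t) ^ Suc k)" by (rule less_exp)
    finally have tb0: "2 * t \<le> b0" using leaves_bound by linarith
    have "B - {b0} \<in> gtree (sep \<theta>) (large \<theta> (6 * k + 4)) b0 (Suc (6 * k + 4))"
      using large_SucD(1)[OF B(2) BX(2)] unfolding b0_def .
    then have "B - {b0} \<in> gtree (sep \<theta>) (large \<theta> (6 * k + 4)) (2 * t) (Suc (6 * k + 4))"
      using gtree_mono[OF tb0] by blast
    \<comment> \<open>Cutting the depth to the required \<open>Suc k\<close> limits the leaves to
      \<open>(2 * t) ^ Suc k\<close>, whose power of 2 stays below \<open>b0\<close>.\<close>
    from gtree_shallow[OF this, of "Suc k"] t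
    obtain B1 where B1: "B1 \<subseteq> B - {b0}" "B1 \<in> gtree (sep \<theta>) (large \<theta> (6 * k + 4)) (2 * t) (Suc k)"
      by auto
    obtain R where R: "finite R" "card R \<le> (2 * t) ^ Suc k"
        "R \<in> gtree (Union_rel (sep \<theta>)) (range (\<lambda>x. {x})) (2 * t) (Suc k)"
        "\<forall>Z \<in> R. Z \<in> large \<theta> (6 * k + 4) \<and> Z \<subseteq> B1"
      using gtree_leaves[OF hereditary_sep B1(2)] by blast
    have RB: "Z \<subseteq> B" "Z \<subseteq> X" if "Z \<in> R" for Z using that R(4) B1(1) BX(1) by blast+

    \<comment> \<open>First pigeonhole: elements of a leaf are coloured by their pattern towards all
      of \<open>X\<close> below it. Afterwards the colour from an earlier \<open>x\<close> depends
      on \<open>x\<close> and the leaf only.\<close>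
    have "\<forall>Z \<in> R. \<exists>Z' \<subseteq> Z. Z' \<in> large \<theta> (6 * k + 2) \<and>
      (\<forall>x \<in> X. x < Min Z \<longrightarrow> (\<forall>y \<in> Z'. \<forall>y' \<in> Z'. P x y = P x y'))"
    proof
      fix Z assume Z: "Z \<in> R"
      let ?S = "X \<inter> {..<Min Z}"
      have lZ: "Z \<in> large \<theta> (Suc (Suc (6 * k + 2)))" using R(4) Z by (simp add: eval_nat_numeral)
      have "Min Z \<in> X" using large_finite_nonempty[OF lZ] Min_in RB(2)[OF Z] by blast
      then have "card (Pow ?S) \<le> Min Z" by (rule sparse_growth_below[OF X(3,2)])
      then have "\<exists>Z' \<subseteq> Z. Z' \<in> large \<theta> (6 * k + 2) \<and>
          (\<forall>y \<in> Z'. \<forall>y' \<in> Z'. {x \<in> ?S. P x y} = {x \<in> ?S. P x y'})"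
        by (intro pigeonhole[OF RB(2)[OF Z] lZ, of "Pow ?S"]) auto
      then obtain Z' where Z': "Z' \<subseteq> Z" "Z' \<in> large \<theta> (6 * k + 2)"
        "\<forall>y \<in> Z'. \<forall>y' \<in> Z'. {x \<in> ?S. P x y} = {x \<in> ?S. P x y'}" by blast
      have "P x y = P x y'" if "x \<in> X" "x < Min Z" "y \<in> Z'" "y' \<in> Z'" for x y y'
      proof -
        have "{x \<in> ?S. P x y} = {x \<in> ?S. P x y'}" using Z'(3) that(3,4) by blast
        then have "x \<in> {x \<in> ?S. P x y} \<longleftrightarrow> x \<in> {x \<in> ?S. P x y'}" by (rule arg_cong)
        then show ?thesis using that(1,2) by simp
      qed
      then show "\<exists>Z' \<subseteq> Z. Z' \<in> large \<theta> (6 * k + 2) \<and>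
          (\<forall>x \<in> X. x < Min Z \<longrightarrow> (\<forall>y \<in> Z'. \<forall>y' \<in> Z'. P x y = P x y'))"
        using Z'(1,2) by blast
    qed
    from bchoice[OF this] obtain S where SR: "\<forall>Z \<in> R. S Z \<subseteq> Z \<and> S Z \<in> large \<theta> (6 * k + 2) \<and>
      (\<forall>x \<in> X. x < Min Z \<longrightarrow> (\<forall>y \<in> S Z. \<forall>y' \<in> S Z. P x y = P x y'))" ..
    have "6 * k + 2 = Suc (Suc (6 * k))" by simp
    with SR have S: "S Z \<subseteq> Z" "S Z \<in> large \<theta> (Suc (Suc (6 * k)))" if "Z \<in> R" for Z
      using that by metis+
    have S_col: "P x y = P x y'" if "Z \<in> R" "x \<in> X" "x < Min Z" "y \<in> S Z" "y' \<in> S Z" for Z x y y'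
      using SR that by blast
    have S_Min: "Min (S Z) \<in> S Z" if "Z \<in> R" for Z
      using large_finite_nonempty[OF S(2)[OF that]] by simp

    \<comment> \<open>Second pigeonhole: \<open>Min (S W)\<close> now represents \<open>W\<close>
      for all earlier elements, so an element is coloured by a set of leaves. There are at most
      \<open>2 ^ card R\<close> such sets, a number not exceeding \<open>b0\<close>.\<close>
    have "\<forall>Z \<in> R. \<exists>Z' \<subseteq> S Z. Z' \<in> large \<theta> (6 * k) \<and>
      (\<forall>x \<in> Z'. \<forall>x' \<in> Z'. {W \<in> R. P x (Min (S W))} = {W \<in> R. P x' (Min (S W))})"
    proof
      fix Z assume Z: "Z \<in> R"
      have "S Z \<subseteq> X" using S(1)[OF Z] RB(2)[OF Z] by blast
      moreover have "card (Pow R) \<le> Min (S Z)"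
      proof -
        have "card (Pow R) \<le> 2 ^ ((2 * t) ^ Suc k)"
          using R(1,2) by (simp add: card_Pow power_increasing del: power_Suc)
        moreover have "b0 \<le> Min (S Z)" using b0(2) S_Min[OF Z] S(1)[OF Z] RB(1)[OF Z] by blast
        ultimately show ?thesis using leaves_bound by linarith
      qed
      ultimately show "\<exists>Z' \<subseteq> S Z. Z' \<in> large \<theta> (6 * k) \<and>
          (\<forall>x \<in> Z'. \<forall>x' \<in> Z'. {W \<in> R. P x (Min (S W))} = {W \<in> R. P x' (Min (S W))})"
        using R(1) by (intro pigeonhole[OF _ S(2)[OF Z], of "Pow R"]) auto
    qed
    from bchoice[OF this] obtain T where T: "\<forall>Z \<in> R. T Z \<subseteq> S Z \<and> T Z \<in> large \<theta> (6 * k) \<and>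
      (\<forall>x \<in> T Z. \<forall>x' \<in> T Z. {W \<in> R. P x (Min (S W))} = {W \<in> R. P x' (Min (S W))})" ..
    have T_Min: "Min (T Z) \<in> T Z" if "Z \<in> R" for Z
      using T that large_finite_nonempty[of "T Z"] Min_in[of "T Z"] by blast
    have T_col: "P x (Min (S W)) = P (Min (T Z)) (Min (S W))" if "Z \<in> R" "W \<in> R" "x \<in> T Z" for x Z W
    proof -
      have "{W \<in> R. P x (Min (S W))} = {W \<in> R. P (Min (T Z)) (Min (S W))}"
        using T that(1,3) T_Min[OF that(1)] by blast
      then have "W \<in> {W \<in> R. P x (Min (S W))} \<longleftrightarrow> W \<in> {W \<in> R. P (Min (T Z)) (Min (S W))}"
        by (rule arg_cong)
      then show ?thesis using that(2) by simp
    qed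
    have "\<forall>Z \<in> R. \<exists>H. H \<subseteq> T Z \<and> transitive_on P H \<and> H \<in> large \<theta> k"
    proof
      fix Z assume Z: "Z \<in> R"
      have "T Z \<subseteq> X" "T Z \<in> large \<theta> (6 * k)" using T S(1)[OF Z] RB(2)[OF Z] Z by blast+
      then show "\<exists>H. H \<subseteq> T Z \<and> transitive_on P H \<and> H \<in> large \<theta> k" using IH by blast
    qed
    from bchoice[OF this] obtain H where
      H: "\<forall>Z \<in> R. H Z \<subseteq> T Z \<and> transitive_on P (H Z) \<and> H Z \<in> large \<theta> k" ..
    have HS: "H Z \<subseteq> S Z" "H Z \<subseteq> Z" "H Z \<subseteq> B" if "Z \<in> R" for Z
      using that H T S(1)[OF that] RB(1)[OF that] by blast+

    \<comment> \<open>As \<open>x0\<close> precedes all leaves, its colour towards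
      \<open>S Z\<close> is a colouring of the leaves themselves, made constant by one more
      pigeonhole.\<close>
    have "\<exists>c \<in> UNIV. \<exists>R' \<subseteq> R. R' \<in> gtree (Union_rel (sep \<theta>)) (range (\<lambda>x. {x})) t (Suc k) \<and>
        (\<lambda>Z. P x0 (Min (S Z))) ` R' \<subseteq> {c}"
      by (rule gtree_pigeonhole_elements[OF hereditary_Union_rel[OF hereditary_sep] _ _ _ R(3)]) auto
    then obtain c R1 where R1: "R1 \<subseteq> R" "R1 \<in> gtree (Union_rel (sep \<theta>)) (range (\<lambda>x. {x})) t (Suc k)"
        "\<And>Z. Z \<in> R1 \<Longrightarrow> P x0 (Min (S Z)) = c"
      by (simp only: image_subset_iff singleton_iff) blast
    obtain R2 where R2: "R2 \<subseteq> R1"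
        "R2 \<in> homogeneous_trees (Union_rel (sep \<theta>)) (\<lambda>Z W. P (Min (T Z)) (Min (S W))) p (Suc k)"
      using tree_ramsey[OF hereditary_Union_rel[OF hereditary_sep] p(3) kp R1(2)[unfolded t_def]] by blast
    have R2R: "Z \<in> R" if "Z \<in> R2" for Z using that R1(1) R2(1) by blast
    define U where "U = \<Union>(H ` R2)"
    have before: "x < Min W" if "W \<in> R" "\<And>w. w \<in> W \<Longrightarrow> x < w" for x W
    proof -
      have "Min W \<in> W" using that(1) R(4) large_finite_nonempty[of W] Min_in[of W] by blast
      then show ?thesis using that(2) by blast
    qed
    have U: "U \<in> gtree (sep \<theta>) (large \<theta> k) p (Suc k) \<and> transitive_on P U"
      unfolding U_def
    proof (rule homogeneous_trees_Union[OF R2(2)])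
      fix Z W x y
      assume ZW: "Z \<in> R2" "W \<in> R2" "set_less Z W" and xy: "x \<in> H Z" "y \<in> H W"
      note ZR = R2R[OF ZW(1)] and WR = R2R[OF ZW(2)]
      have x: "x \<in> Z" "x \<in> X" "x \<in> T Z" using xy(1) HS[OF ZR] RB(2)[OF ZR] H ZR by blast+
      have "x < Min W" using before[OF WR] ZW(3) x(1) unfolding set_less_def by blast
      then have "P x y = P x (Min (S W))"
        using S_col[OF WR x(2)] xy(2) HS(1)[OF WR] S_Min[OF WR] by blast
      also have "\<dots> = P (Min (T Z)) (Min (S W))" by (rule T_col[OF ZR WR x(3)])
      finally show "P x y = P (Min (T Z)) (Min (S W))" .
    next
      fix Z assume "Z \<in> R2"
      from R2R[OF this] show "H Z \<subseteq> Z \<and> H Z \<in> large \<theta> k \<and> transitive_on P (H Z)"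
        using HS(2) H by blast
    qed (use large_finite_nonempty in blast)
    have UB: "U \<subseteq> B" unfolding U_def using HS(3) R2R by blast
    have x0U: "x0 < y" if "y \<in> U" for y using that UB B(1) x0_less by blast
    have "insert x0 U \<in> large \<theta> (Suc k)"
    proof (rule large_insert[where b = p])
      show "0 \<notin> U" using UB BX(2) by blast
    qed (use x0 x0U p(1) U in auto)
    moreover have "transitive_on P (insert x0 U)"
    proof (rule transitive_on_insert)
      fix y assume "y \<in> U"
      then obtain Z where Z: "Z \<in> R2" "y \<in> H Z" unfolding U_def by blast
      note ZR = R2R[OF Z(1)]
      have "x0 < Min Z" using before[OF ZR] RB(1)[OF ZR] B(1) x0_less by blast
      then have "P x0 y = P x0 (Min (S Z))"
        using S_col[OF ZR x0(1)] Z(2) HS(1)[OF ZR] S_Min[OF ZR] by blast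
      also have "\<dots> = c" using R1(3) Z(1) R2(1) by blast
      finally show "P x0 y = c" .
    qed (use U x0U in auto)
    moreover have "insert x0 U \<subseteq> X" using UB BX(1) x0(1) by blast
    ultimately show ?thesis by blast
  qed
qed

lemma large_transitive:
  assumes "finite X" "0 \<notin> X" "sparse growth X" "X \<in> large \<theta> (6 * k)"
  shows "\<exists>H \<subseteq> X. transitive_on P H \<and> H \<in> large \<theta> k"
  using assms
proof (induction k arbitrary: X)
  case 0
  then obtain x where "x \<in> X" by auto
  then show ?case by (intro exI[of _ "{x}"]) (simp add: transitive_on_def)
next
  case (Suc k)
  show ?case
  proof (rule large_transitive_step[OF Suc.prems(1-3)])
    show "X \<in> large \<theta> (Suc (6 * k + 5))" using Suc.prems(4) by (simp add: eval_nat_numeral)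
    fix Z assume Z: "Z \<subseteq> X" "Z \<in> large \<theta> (6 * k)"
    then have "finite Z" "0 \<notin> Z" "sparse growth Z"
      using Suc.prems finite_subset unfolding sparse_def by blast+
    then show "\<exists>H \<subseteq> Z. transitive_on P H \<and> H \<in> large \<theta> k" using Suc.IH Z(2) by blast
  qed
qed

section \<open>From relations back to colourings\<close>

lemma transitive_for_if_transitive_on:
  assumes f: "f \<in> [X]\<^bsup>2\<^esup> \<rightarrow> {..<2}" and H: "H \<subseteq> X" "transitive_on (\<lambda>x y. f {x, y} = 1) H"
  shows "transitive_for f H"
  unfolding transitive_for_def
proof (intro allI impI ballI)
  fix i x y z :: nat
  assume "i < 2" and xyz: "x \<in> H" "y \<in> H" "z \<in> H" "x < y \<and> y < z"
    and i: "f {x, y} = i \<and> f {y, z} = i"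
  have "{x, z} \<in> [X]\<^bsup>2\<^esup>"
    using xyz H(1) by (auto simp: nsets_def card_insert_if)
  \<comment> \<open>Only the values 0 and 1 occur, so a colour is determined by whether it equals
    1.\<close>
  from Pi_mem[OF f this] have "f {x, z} < 2" unfolding lessThan_iff .
  moreover have "(f {x, z} = 1) = (f {x, y} = 1)"
    using H(2)[unfolded transitive_on_def, rule_format, of x y z] xyz i by simp
  moreover have "f {x, y} = i" using i by blast
  ultimately show "f {x, z} = i" using \<open>i < 2\<close> by linarith
qed

theorem theorem3p28:
  fixes \<theta> :: delta0
  assumes "free_vars \<theta> \<subseteq> {0, 1, 2}"
  shows "\<exists>g. primitive_recursive g \<and>
    (\<forall>k X. finite X \<and> X \<in> large (rel3 \<theta>) (6 * k) \<and> sparse g X \<longrightarrow> EM_large (rel3 \<theta>) k X)"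
proof (intro exI[of _ growth] conjI allI impI primitive_recursive_growth)
  fix k X
  assume X: "finite X \<and> X \<in> large (rel3 \<theta>) (6 * k) \<and> sparse growth X"
  show "EM_large (rel3 \<theta>) k X"
    unfolding EM_large_def
  proof
    fix f assume f: "f \<in> [X]\<^bsup>2\<^esup> \<rightarrow> {..<2::nat}"
    show "\<exists>H \<subseteq> X. transitive_for f H \<and> H \<in> large (rel3 \<theta>) k"
    proof (cases "0 \<in> X")
      case True
      then show ?thesis
        using zero_large by (intro exI[of _ "{0}"]) (simp add: transitive_for_def)
    next
      case False
      then obtain H where "H \<subseteq> X" "transitive_on (\<lambda>x y. f {x, y} = 1) H" "H \<in> large (rel3 \<theta>) k"
        using large_transitive X by blast
      then show ?thesis using transitive_for_if_transitive_on[OF f] by blast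
    qed
  qed
qed

end
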